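(* Let $K\geq 1$ and let $f=h+\overline{g}\in\mathcal{S}_H^{0}$ be a $K$-quasiconformal harmonic mapping, where $$h(z)=z+\sum_{n=2}^{\infty}a_nz^n\quad\text{and}\quad g(z)=\sum_{n=2}^{\infty}b_nz^n .$$ Let $\Omega=f(\mathbb{D})$ and, for $z\in\mathbb{D}$, let $B(z)=\{\zeta:\ |z|\leq|\zeta|<1,\ |\arg z-\arg\zeta|\leq\pi(1-|z|)\}$. Suppose that $f$ satisfies at least one of the following two conditions: (b) there is a positive constant $M_1$ such that $\operatorname{diam} f(B(z))\leq M_1\,d_\Omega(f(z))$ for all $z\in\mathbb{D}$; (c) there are constants $\delta\in(0,1)$ and $M_2>0$ such that $\|D_f(\zeta)\|\leq M_2\,\|D_f(z)\|\left(\frac{1-|\zeta|}{1-|z|}\right)^{\delta-1}$ for all $z\in\mathbb{D}$ and $\zeta\in B(z)$. Then there is some $\beta_0>0$ such that $$\sum_{n=2}^{\infty}n^{1+\beta_0}\left(|a_n|^2+|b_n|^2\right)<\infty .$$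
   Context: $\mathbb{D}$ is the open unit disk in $\mathbb{C}$. A harmonic mapping in $\mathbb{D}$ is a complex-valued function whose real and imaginary parts are real harmonic; it can be written $f=h+\overline{g}$ with $h,g$ analytic, unique with $g(0)=0$. $\mathcal{S}_H$ is the family of sense-preserving univalent harmonic mappings $f=h+\overline{g}$ in $\mathbb{D}$ with $h(0)=g(0)=0$, $h'(0)=1$; $\mathcal{S}_H^{0}$ is the subfamily with $g'(0)=0$. $\|D_f\|=|f_z|+|f_{\overline z}|$, $l(D_f)=\big||f_z|-|f_{\overline z}|\big|$, where $f_z=\frac12(f_x-if_y)$, $f_{\overline z}=\frac12(f_x+if_y)$; $\det D_f=|f_z|^2-|f_{\overline z}|^2$. For $K\ge1$, a sense-preserving homeomorphism $f$ of a domain $\Omega_0$ onto a domain $\Omega_0'$, in the Sobolev class $W^{1,2}_{loc}(\Omega_0)$, is $K$-quasiconformal if $\|D_f(z)\|^2\le K\det D_f(z)$, i.e. $\|D_f(z)\|\le K\,l(D_f(z))$, for $z\in\Omega_0$. $d_\Omega(w)$ is the Euclidean distance from $w$ to $\partial\Omega$; $\operatorname{diam}$ is the Euclidean diameter. Differences of arguments are taken modulo $2\pi$, with values in $[-\pi,\pi]$, and $B(0)=\mathbb{D}$. *)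

theory Defs
  imports "HOL-Complex_Analysis.Complex_Analysis"
begin

section \<open>Partial derivatives\<close>

definition dx :: "(complex \<Rightarrow> 'a::real_normed_vector) \<Rightarrow> complex \<Rightarrow> 'a"
  where "dx f z = vector_derivative (\<lambda>t::real. f (z + of_real t)) (at 0)"

definition dy :: "(complex \<Rightarrow> 'a::real_normed_vector) \<Rightarrow> complex \<Rightarrow> 'a"
  where "dy f z = vector_derivative (\<lambda>t::real. f (z + \<i> * of_real t)) (at 0)"

definition wirtinger :: "(complex \<Rightarrow> complex) \<Rightarrow> complex \<Rightarrow> complex"
  where "wirtinger f z = (dx f z - \<i> * dy f z) / 2"

definition wirtinger_bar :: "(complex \<Rightarrow> complex) \<Rightarrow> complex \<Rightarrow> complex"
  where "wirtinger_bar f z = (dx f z + \<i> * dy f z) / 2"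

definition norm_D :: "(complex \<Rightarrow> complex) \<Rightarrow> complex \<Rightarrow> real"
  where "norm_D f z = cmod (wirtinger f z) + cmod (wirtinger_bar f z)"

definition det_D :: "(complex \<Rightarrow> complex) \<Rightarrow> complex \<Rightarrow> real"
  where "det_D f z = (cmod (wirtinger f z))\<^sup>2 - (cmod (wirtinger_bar f z))\<^sup>2"


section \<open>Harmonic mappings\<close>

definition C1_on :: "complex set \<Rightarrow> (complex \<Rightarrow> real) \<Rightarrow> bool"
  where "C1_on \<Omega> u \<longleftrightarrow>
    (\<forall>z\<in>\<Omega>. u differentiable (at z)) \<and> continuous_on \<Omega> (dx u) \<and> continuous_on \<Omega> (dy u)"

definition real_harmonic_on :: "complex set \<Rightarrow> (complex \<Rightarrow> real) \<Rightarrow> bool"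
  where "real_harmonic_on \<Omega> u \<longleftrightarrow>
    C1_on \<Omega> u \<and> C1_on \<Omega> (dx u) \<and> C1_on \<Omega> (dy u) \<and>
    (\<forall>z\<in>\<Omega>. dx (dx u) z + dy (dy u) z = 0)"

definition harmonic_map_on :: "complex set \<Rightarrow> (complex \<Rightarrow> complex) \<Rightarrow> bool"
  where "harmonic_map_on \<Omega> f \<longleftrightarrow>
    real_harmonic_on \<Omega> (\<lambda>z. Re (f z)) \<and> real_harmonic_on \<Omega> (\<lambda>z. Im (f z))"

abbreviation unit_disk :: "complex set"  (\<open>\<D>\<close>)
  where "\<D> \<equiv> ball 0 1"

definition canonical_decomposition ::
    "(complex \<Rightarrow> complex) \<Rightarrow> (complex \<Rightarrow> complex) \<Rightarrow> (complex \<Rightarrow> complex) \<Rightarrow> bool"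
  where "canonical_decomposition f h g \<longleftrightarrow>
    h holomorphic_on \<D> \<and> g holomorphic_on \<D> \<and> g 0 = 0 \<and> (\<forall>z\<in>\<D>. f z = h z + cnj (g z))"

text \<open>Orientation in the topological sense, so that it applies to homeomorphisms that need not be
  smooth: the image of a positively oriented circle winds once around the image of its centre.
  It is only used for continuous injective maps; these have local degree 1 or -1 at
  each point.\<close>

definition sense_preserving_on :: "complex set \<Rightarrow> (complex \<Rightarrow> complex) \<Rightarrow> bool"
  where "sense_preserving_on \<Omega> f \<longleftrightarrow>
    (\<forall>z r. 0 < r \<and> cball z r \<subseteq> \<Omega> \<longrightarrow> winding_number (f \<circ> circlepath z r) (f z) = 1)"

definition S_H :: "(complex \<Rightarrow> complex) set"
  where "S_H = {f. harmonic_map_on \<D> f \<and> inj_on f \<D> \<and> sense_preserving_on \<D> f \<and>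
    (\<exists>h g. canonical_decomposition f h g \<and> h 0 = 0 \<and> deriv h 0 = 1)}"

definition S_H0 :: "(complex \<Rightarrow> complex) set"
  where "S_H0 = {f \<in> S_H. \<exists>h g. canonical_decomposition f h g \<and> deriv g 0 = 0}"


section \<open>The Sobolev class and quasiconformal mappings\<close>

text \<open>Coinduction yields exactly the infinitely differentiable functions: partial derivatives of
  all orders exist and are differentiable.\<close>

coinductive smooth :: "(complex \<Rightarrow> real) \<Rightarrow> bool"
  where "(\<And>z. \<phi> differentiable (at z)) \<Longrightarrow> smooth (dx \<phi>) \<Longrightarrow> smooth (dy \<phi>) \<Longrightarrow> smooth \<phi>"

definition test_function_on :: "complex set \<Rightarrow> (complex \<Rightarrow> real) \<Rightarrow> bool"
  where "test_function_on \<Omega> \<phi> \<longleftrightarrow>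
    smooth \<phi> \<and> compact (closure {z. \<phi> z \<noteq> 0}) \<and> closure {z. \<phi> z \<noteq> 0} \<subseteq> \<Omega>"

definition L2_loc :: "complex set \<Rightarrow> (complex \<Rightarrow> complex) \<Rightarrow> bool"
  where "L2_loc \<Omega> f \<longleftrightarrow>
    set_borel_measurable lebesgue \<Omega> f \<and>
    (\<forall>C. compact C \<and> C \<subseteq> \<Omega> \<longrightarrow> set_integrable lebesgue C (\<lambda>z. (cmod (f z))\<^sup>2))"

definition W12_loc :: "complex set \<Rightarrow> (complex \<Rightarrow> complex) \<Rightarrow> bool"
  where "W12_loc \<Omega> f \<longleftrightarrow> L2_loc \<Omega> f \<and>
    (\<exists>p q. L2_loc \<Omega> p \<and> L2_loc \<Omega> q \<and>
      (\<forall>\<phi>. test_function_on \<Omega> \<phi> \<longrightarrow>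
        (LINT z:\<Omega>|lebesgue. dx \<phi> z *\<^sub>R f z) = - (LINT z:\<Omega>|lebesgue. \<phi> z *\<^sub>R p z) \<and>
        (LINT z:\<Omega>|lebesgue. dy \<phi> z *\<^sub>R f z) = - (LINT z:\<Omega>|lebesgue. \<phi> z *\<^sub>R q z)))"

definition is_domain :: "complex set \<Rightarrow> bool"
  where "is_domain \<Omega> \<longleftrightarrow> open \<Omega> \<and> connected \<Omega> \<and> \<Omega> \<noteq> {}"

text \<open>The dilatation inequality is required at every point of the domain, with classical partial
  derivatives; for a map that is not smooth one would ask for it almost everywhere.\<close>

definition quasiconformal ::
    "real \<Rightarrow> complex set \<Rightarrow> complex set \<Rightarrow> (complex \<Rightarrow> complex) \<Rightarrow> bool"
  where "quasiconformal K \<Omega> \<Omega>' f \<longleftrightarrow>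
    K \<ge> 1 \<and> is_domain \<Omega> \<and> is_domain \<Omega>' \<and>
    (\<exists>k. homeomorphism \<Omega> \<Omega>' f k) \<and> sense_preserving_on \<Omega> f \<and> W12_loc \<Omega> f \<and>
    (\<forall>z\<in>\<Omega>. (norm_D f z)\<^sup>2 \<le> K * det_D f z)"


section \<open>Carleson boxes and distance to the boundary\<close>

text \<open>For nonzero arguments, \<open>Arg (z / \<zeta>)\<close> is the difference of the arguments of \<open>z\<close> and \<open>\<zeta>\<close>
  modulo \<open>2 * pi\<close>, with values in \<open>{-pi<..pi}\<close>. Since \<open>Arg 0 = 0\<close>, the box at the origin is the
  whole disk.\<close>

definition carleson_box :: "complex \<Rightarrow> complex set"
  where "carleson_box z =
    {\<zeta>. cmod z \<le> cmod \<zeta> \<and> cmod \<zeta> < 1 \<and> \<bar>Arg (z / \<zeta>)\<bar> \<le> pi * (1 - cmod z)}"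

lemma carleson_box_0: "carleson_box 0 = \<D>"
  by (auto simp: carleson_box_def Arg_zero)

text \<open>\<^const>\<open>infdist\<close> to the empty set is 0. This case does not occur for the image of the disk under
  a univalent harmonic map, which is never the whole plane.\<close>

definition boundary_dist :: "complex set \<Rightarrow> complex \<Rightarrow> real"
  where "boundary_dist \<Omega> w = infdist w (frontier \<Omega>)"

text \<open>The library's \<^const>\<open>diameter\<close> is real-valued and meaningless on unbounded sets, whose
  diameter is infinite; hence the explicit boundedness.\<close>

definition diam_le :: "complex set \<Rightarrow> real \<Rightarrow> bool"
  where "diam_le S r \<longleftrightarrow> bounded S \<and> diameter S \<le> r"

end

theory Submission
  imports Defs
begin

text \<open>Write \<open>A(r)\<close> for the integral of \<open>\<bar>h'\<bar>\<^sup>2\<close> over the circle of radius \<open>r\<close> with respect to the angle.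
  The theorem is about the energy of \<open>f\<close> near the boundary: it follows once the integral of \<open>r * A(r)\<close> over
  \<open>\<rho> \<le> r < 1\<close> is known to decay like a power of \<open>1 - \<rho>\<close>. Indeed, by Parseval's identity this integral is,
  up to a constant, the sum of the \<open>n * \<bar>a n\<bar>\<^sup>2\<close> with weights bounded below for \<open>n \<ge> 1 / (1 - \<rho>)\<close>
  (\<open>coefficient_tail_of_energy_decay\<close>, \<open>summable_powr_of_tail_decay\<close>). The bound \<open>\<bar>g'\<bar> \<le> \<bar>h'\<bar>\<close> carries the
  decay over to the coefficients of \<open>g\<close>.

  The power decay comes from a reverse inequality: the energy of the annulus \<open>\<rho> \<le> \<bar>z\<bar> < 1\<close> is at most a
  constant times \<open>(1 - \<rho>) * A(\<rho>)\<close>. As \<open>- \<rho> * A(\<rho>)\<close> is the derivative of that energy with respect to \<open>\<rho>\<close>,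
  this is a differential inequality whose solutions decay (\<open>tail_integral_decay\<close>).

  The reverse inequality rests on three facts. By quasiconformality the energy density \<open>\<bar>h'\<bar>\<^sup>2\<close> is at most
  \<open>K\<close> times the Jacobian of \<open>f\<close>. By injectivity the integral of the Jacobian over a Carleson box is the area
  of its image (\<open>polar_area_le\<close>). Finally, each of the two alternative hypotheses bounds the diameter of
  the image of the box at \<open>z\<close> by a constant times \<open>(1 - \<bar>z\<bar>) * \<bar>h' z\<bar>\<close>; averaging over the boxes at all points of the circle of
  radius \<open>\<rho>\<close> gives the inequality (\<open>annulus_energy_le\<close>). For the condition on the derivative the bound is an
  integration along an arc and a radius (\<open>displacement_of_derivative_growth\<close>). For the condition on the
  diameter one needs that the distance of \<open>f z\<close> to the boundary is at most \<open>4 * (1 - \<bar>z\<bar>) * \<bar>h' z\<bar>\<close>. This is a Schwarz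
  lemma for inverse branches of the analytic part \<open>h\<close> (\<open>harmonic_koebe_upper\<close>), which exist because \<open>h\<close>
  has no critical points (\<open>deriv_nonzero_of_sense_preserving\<close>).\<close>

section \<open>Derivatives and dilatation\<close>

lemma wirtinger_harmonic:
  assumes "canonical_decomposition f h g" and "z \<in> \<D>"
  shows "wirtinger f z = deriv h z" and "wirtinger_bar f z = cnj (deriv g z)"
proof -
  have hol: "h holomorphic_on \<D>" "g holomorphic_on \<D>"
    and f: "\<And>w. w \<in> \<D> \<Longrightarrow> f w = h w + cnj (g w)"
    using assms(1) by (auto simp: canonical_decomposition_def)
  have dh: "(h has_field_derivative deriv h z) (at z)" "(g has_field_derivative deriv g z) (at z)"
    using hol assms(2) by (auto intro: holomorphic_derivI)
  have *: "vector_derivative (\<lambda>t::real. f (z + c * of_real t)) (at 0)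
      = c * deriv h z + cnj (c * deriv g z)" for c
  proof (rule vector_derivative_at)
    have lin: "((\<lambda>t::real. z + c * of_real t) has_vector_derivative c) (at 0)"
      by (auto intro!: derivative_eq_intros)
    have "((h \<circ> (\<lambda>t::real. z + c * of_real t)) has_vector_derivative c * deriv h z) (at 0)"
      "((g \<circ> (\<lambda>t::real. z + c * of_real t)) has_vector_derivative c * deriv g z) (at 0)"
      by (rule field_vector_diff_chain_at[OF lin]; use dh in simp)+
    then have "((\<lambda>t::real. h (z + c * of_real t) + cnj (g (z + c * of_real t)))
        has_vector_derivative c * deriv h z + cnj (c * deriv g z)) (at 0)"
      by (intro derivative_intros) (auto simp: o_def)
    moreover have "open ((\<lambda>t::real. z + c * of_real t) -` \<D>)"
      by (intro open_vimage continuous_intros open_ball)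
    ultimately show "((\<lambda>t::real. f (z + c * of_real t)) has_vector_derivative
        c * deriv h z + cnj (c * deriv g z)) (at 0)"
      by (rule has_vector_derivative_transform_within_open) (use assms(2) f in auto)
  qed
  have "dx f z = deriv h z + cnj (deriv g z)"
    using *[of 1] by (simp add: dx_def)
  moreover have "dy f z = \<i> * deriv h z + cnj (\<i> * deriv g z)"
    using *[of \<i>] by (simp only: dy_def)
  then have "\<i> * dy f z = cnj (deriv g z) - deriv h z"
    by (simp add: ring_distribs mult.assoc[symmetric])
  ultimately show "wirtinger f z = deriv h z" "wirtinger_bar f z = cnj (deriv g z)"
    by (simp_all add: wirtinger_def wirtinger_bar_def)
qed

text \<open>After division by \<open>x + y\<close> the hypothesis becomes \<open>x + y \<le> K * (x - y)\<close>, which is linear in \<open>y\<close>.\<close>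
lemma dilatation_bounds:
  fixes x y K :: real
  assumes "0 \<le> x" "0 \<le> y" "(x + y)\<^sup>2 \<le> K * (x\<^sup>2 - y\<^sup>2)" "K \<ge> 1"
  shows "y \<le> (K - 1) / (K + 1) * x" and "x\<^sup>2 \<le> K * (x\<^sup>2 - y\<^sup>2)"
proof -
  have "x\<^sup>2 \<le> (x + y)\<^sup>2" using assms by (intro power_mono) auto
  then show "x\<^sup>2 \<le> K * (x\<^sup>2 - y\<^sup>2)" using assms by linarith
  have *: "(x + y) * (x + y) \<le> (x + y) * (K * (x - y))"
    using assms(3) by (simp add: power2_eq_square algebra_simps)
  have "x + y \<le> K * (x - y)"
  proof (cases "x + y = 0")
    case False
    then have "x + y > 0" using assms by linarith
    with * show ?thesis by (simp only: mult_le_cancel_left_pos)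
  qed (use assms in auto)
  then have "y * (K + 1) \<le> (K - 1) * x" by (simp add: algebra_simps)
  moreover have "K + 1 > 0" using assms by simp
  ultimately show "y \<le> (K - 1) / (K + 1) * x" by (simp add: field_simps)
qed

section \<open>The analytic part has no critical points\<close>

text \<open>The model for the behaviour of a harmonic map near a zero of order \<open>n\<close> of its analytic part.\<close>
lemma winding_number_power_circle:
  fixes p c :: complex
  assumes "c \<noteq> 0" "r > 0"
  shows "winding_number (\<lambda>t. p + c * (circlepath z r t - z) ^ n) p = of_nat n"
proof -
  define \<gamma> where "\<gamma> = (\<lambda>t. p + c * (circlepath z r t - z) ^ n)"
  have \<gamma>: "\<gamma> = (\<lambda>t. p + c * of_real r ^ n * exp (2 * of_real pi * \<i> * of_nat n * of_real t))"
    unfolding \<gamma>_def circlepath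
    by (simp add: fun_eq_iff power_mult_distrib exp_of_nat_mult[symmetric] mult_ac)
  define d where "d t = 2 * of_real pi * \<i> * of_nat n * (\<gamma> t - p)" for t
  have der: "(\<gamma> has_vector_derivative d t) (at t within S)" for t S
  proof -
    have "((\<lambda>w. p + c * of_real r ^ n * exp (2 * of_real pi * \<i> * of_nat n * w))
        has_field_derivative d t) (at (of_real t))"
      unfolding d_def \<gamma> by (auto intro!: derivative_eq_intros)
    then show ?thesis
      unfolding \<gamma> using has_vector_derivative_real_field by blast
  qed
  have "continuous_on {0..1} d"
    unfolding d_def \<gamma> by (intro continuous_intros)
  then have "valid_path \<gamma>"
    unfolding valid_path_def using der
    by (intro C1_differentiable_imp_piecewise) (auto simp: C1_differentiable_on_def)
  have ne: "\<gamma> t \<noteq> p" for t using assms by (simp add: \<gamma>)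
  have "((\<lambda>t. 1 / (\<gamma> t - p) * vector_derivative \<gamma> (at t within {0..1}))
      has_integral 2 * of_real pi * \<i> * of_nat n) {0..1}"
  proof (rule has_integral_eq)
    show "((\<lambda>t. 2 * of_real pi * \<i> * of_nat n) has_integral 2 * of_real pi * \<i> * of_nat n) {0..1::real}"
      using has_integral_const_real[of "2 * of_real pi * \<i> * of_nat n::complex" 0 1] by simp
    show "2 * of_real pi * \<i> * of_nat n = 1 / (\<gamma> t - p) * vector_derivative \<gamma> (at t within {0..1})"
      if "t \<in> {0..1}" for t
      using vector_derivative_within_cbox[OF _ that[unfolded cbox_interval[symmetric]] der] ne[of t]
      by (simp add: d_def)
  qed
  then have "contour_integral \<gamma> (\<lambda>w. 1 / (w - p)) = 2 * of_real pi * \<i> * of_nat n"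
    by (intro contour_integral_unique) (simp add: has_contour_integral_def)
  then show ?thesis
    using winding_number_valid_path[OF \<open>valid_path \<gamma>\<close>, of p] ne
    unfolding \<gamma>_def[symmetric] by (auto simp: path_image_def)
qed

text \<open>Were z a critical point of h, then h - h(z) would vanish there to some order n \<ge> 2. The
  dilatation bound makes g - g(z) at most about k < 1 times as large, so by Rouche's argument
  f - f(z) winds n times around 0 on small circles, against the orientation hypothesis. This
  replaces Lewy's theorem, and it is where the strict bound k < 1 matters.\<close>
lemma deriv_nonzero_of_sense_preserving:
  fixes f h g :: "complex \<Rightarrow> complex"
  assumes hol: "h holomorphic_on S" "g holomorphic_on S" and S: "open S" "connected S"
    and f: "\<And>w. w \<in> S \<Longrightarrow> f w = h w + cnj (g w)"
    and k: "0 \<le> k" "k < 1" "\<And>w. w \<in> S \<Longrightarrow> cmod (deriv g w) \<le> k * cmod (deriv h w)"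
    and sp: "sense_preserving_on S f"
    and nonconst: "z0 \<in> S" "deriv h z0 \<noteq> 0" and "z \<in> S"
  shows "deriv h z \<noteq> 0"
proof -
  have "\<exists>n>0. (deriv ^^ n) h z \<noteq> 0"
  proof (rule ccontr)
    assume *: "\<not> (\<exists>n>0. (deriv ^^ n) h z \<noteq> 0)"
    have der0: "(deriv ^^ n) h z = 0" if "n > 0" for n using * that by blast
    have "h w = h z" if "w \<in> S" for w
      using holomorphic_fun_eq_const_on_connected[OF hol(1) S der0 \<open>z \<in> S\<close> that] by simp
    then have "((\<lambda>w. h z) has_field_derivative deriv h z0) (at z0)"
      using holomorphic_derivI[OF hol(1) S(1) nonconst(1)] S nonconst(1)
      by (auto intro: has_field_derivative_transform_within_open)
    then have "deriv h z0 = 0" using DERIV_unique DERIV_const by blast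
    with nonconst show False by simp
  qed
  define n where "n = (LEAST n. n > 0 \<and> (deriv ^^ n) h z \<noteq> 0)"
  have n: "n > 0" "(deriv ^^ n) h z \<noteq> 0"
    using \<open>\<exists>n>0. (deriv ^^ n) h z \<noteq> 0\<close> LeastI_ex[of "\<lambda>n. n > 0 \<and> (deriv ^^ n) h z \<noteq> 0"]
    unfolding n_def by auto
  have least: "(deriv ^^ i) h z = 0" if "0 < i" "i < n" for i
    using not_less_Least[of i "\<lambda>n. n > 0 \<and> (deriv ^^ n) h z \<noteq> 0"] that unfolding n_def by auto
  obtain u r1 where r1: "0 < r1" and hu: "u holomorphic_on ball z r1"
    and u: "\<And>w. w \<in> ball z r1 \<Longrightarrow> h w - h z = (w - z) ^ n * u w"
    and une: "\<And>w. w \<in> ball z r1 \<Longrightarrow> u w \<noteq> 0"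
    by (rule holomorphic_factor_order_of_zero[OF hol(1) S(1) \<open>z \<in> S\<close> n least]) (assumption+, rule that)
  \<comment> \<open>The errors e and k * e made below stay within the margin (1 - k) * |u z| = 3 * e.\<close>
  define e where "e = (1 - k) * cmod (u z) / 3"
  have e: "e > 0" using k une[of z] r1 by (simp add: e_def)
  obtain r2 where r2: "0 < r2" "ball z r2 \<subseteq> S" using S(1) \<open>z \<in> S\<close> openE by blast
  have cu: "isCont u z" and cu': "isCont (deriv u) z"
    using hu r1 holomorphic_deriv[OF hu] by (auto intro!: holomorphic_on_imp_differentiable_at field_differentiable_imp_continuous_at)
  have "isCont (\<lambda>w. of_nat n * u w + (w - z) * deriv u w) z" by (intro continuous_intros cu cu')
  then obtain r3 where r3: "0 < r3"
    "\<And>w. dist w z < r3 \<Longrightarrow> dist (of_nat n * u w + (w - z) * deriv u w) (of_nat n * u z) < n * e"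
    using e n unfolding continuous_at_eps_delta by (auto dest!: spec[of _ "n * e"])
  obtain r4 where r4: "0 < r4" "\<And>w. dist w z < r4 \<Longrightarrow> dist (u w) (u z) < e"
    using cu e unfolding continuous_at_eps_delta by blast
  define r where "r = Min {r1, r2, r3, r4} / 2"
  have r: "0 < r" "r < r1" "r < r2" "r < r3" "r < r4" using r1 r2 r3 r4 by (auto simp: r_def min_def)
  define B where "B = cmod (u z) + e"
  have dh: "cmod (deriv h w) \<le> cmod (w - z) ^ (n - 1) * (n * B)" if "dist w z \<le> r" for w
  proof -
    have w: "w \<in> ball z r1" "w \<in> S" using that r r2 by (auto simp: dist_commute subset_iff)
    have "(h has_field_derivative of_nat n * (w - z) ^ (n - 1) * u w + (w - z) ^ n * deriv u w) (at w)"
    proof (rule has_field_derivative_transform_within_open)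
      show "((\<lambda>w. h z + (w - z) ^ n * u w) has_field_derivative
          of_nat n * (w - z) ^ (n - 1) * u w + (w - z) ^ n * deriv u w) (at w)"
        using holomorphic_derivI[OF hu _ w(1)] by (auto intro!: derivative_eq_intros)
      show "h z + (v - z) ^ n * u v = h v" if "v \<in> ball z r1" for v using u[OF that] by (simp add: algebra_simps)
    qed (use w in auto)
    then have "deriv h w = of_nat n * (w - z) ^ (n - 1) * u w + (w - z) ^ n * deriv u w"
      by (rule DERIV_imp_deriv)
    also have "(w - z) ^ n = (w - z) ^ (n - 1) * (w - z)" using n by (metis power_minus_mult)
    finally have "deriv h w = (w - z) ^ (n - 1) * (of_nat n * u w + (w - z) * deriv u w)"
      by (simp add: algebra_simps)
    moreover have "cmod (of_nat n * u w + (w - z) * deriv u w) \<le> cmod (of_nat n * u z) + n * e"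
      using r3(2)[of w] that r norm_triangle_sub[of "of_nat n * u w + (w - z) * deriv u w" "of_nat n * u z"]
      by (simp add: dist_norm)
    moreover have "cmod (of_nat n * u z) + n * e = n * B"
      by (simp add: norm_mult B_def algebra_simps)
    ultimately show ?thesis
      by (simp only: norm_mult norm_power mult_left_mono zero_le_power norm_ge_zero)
  qed
  \<comment> \<open>Integrating the bound on h' along the segment from z to w, the factor n of h' cancels, so that
    the constant k survives as the ratio of the two increments.\<close>
  have dg: "cmod (g w - g z) \<le> k * B * cmod (w - z) ^ n" if "dist w z \<le> r" for w
  proof -
    define l where "l = (\<lambda>t::real. z + of_real t * (w - z))"
    have lS: "dist (l t) z \<le> r" "l t \<in> S" if "0 \<le> t" "t \<le> 1" for t
    proof -
      have "dist (l t) z = t * dist w z" using that by (simp add: l_def dist_norm norm_mult)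
      also have "\<dots> \<le> 1 * r" using that \<open>dist w z \<le> r\<close> by (intro mult_mono) auto
      finally show "dist (l t) z \<le> r" by simp
      then show "l t \<in> S" using r r2 by (auto simp: dist_commute subset_iff)
    qed
    have "norm ((g \<circ> l) 1 - (g \<circ> l) 0) \<le> k * B * cmod (w - z) ^ n * 1 ^ n - k * B * cmod (w - z) ^ n * 0 ^ n"
    proof (rule differentiable_bound_general[where f = "g \<circ> l" and a = 0 and b = 1 and f' = "\<lambda>t. (w - z) * deriv g (l t)"
          and \<phi> = "\<lambda>t::real. k * B * cmod (w - z) ^ n * t ^ n" and \<phi>' = "\<lambda>t::real. k * B * cmod (w - z) ^ n * (n * t ^ (n - 1))"])
      have vd: "((g \<circ> l) has_vector_derivative (w - z) * deriv g (l t)) (at t)" if "0 \<le> t" "t \<le> 1" for t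
        by (rule field_vector_diff_chain_at)
          (use holomorphic_derivI[OF hol(2) S(1) lS(2)[OF that]] in \<open>auto simp: l_def intro!: derivative_eq_intros\<close>)
      show "continuous_on {0..1} (g \<circ> l)"
        by (rule continuous_at_imp_continuous_on) (use has_vector_derivative_continuous[OF vd] in auto)
      show "\<And>t. 0 < t \<Longrightarrow> t < 1 \<Longrightarrow> ((g \<circ> l) has_vector_derivative (w - z) * deriv g (l t)) (at t)"
        using vd by simp
      show "norm ((w - z) * deriv g (l t)) \<le> k * B * cmod (w - z) ^ n * (n * t ^ (n - 1))"
        if "0 < t" "t < 1" for t :: real
      proof -
        have "cmod (deriv g (l t)) \<le> k * cmod (deriv h (l t))" using k lS that by auto
        also have "\<dots> \<le> k * (cmod (l t - z) ^ (n - 1) * (n * B))"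
          using k dh lS that by (intro mult_left_mono) auto
        also have "cmod (l t - z) = t * cmod (w - z)" using that by (simp add: l_def norm_mult)
        finally have "cmod (w - z) * cmod (deriv g (l t))
            \<le> cmod (w - z) * (k * ((t * cmod (w - z)) ^ (n - 1) * (n * B)))"
          by (rule mult_left_mono) simp
        also have "\<dots> = k * B * (cmod (w - z) ^ (n - 1) * cmod (w - z)) * (n * t ^ (n - 1))"
          by (simp add: power_mult_distrib)
        also have "cmod (w - z) ^ (n - 1) * cmod (w - z) = cmod (w - z) ^ n"
          using n by (metis power_minus_mult)
        finally show ?thesis by (simp add: norm_mult)
      qed
    qed (auto intro!: continuous_intros derivative_eq_intros simp flip: has_real_derivative_iff_has_vector_derivative)
    then show ?thesis using n by (simp add: l_def zero_power)
  qed
  have "winding_number (f \<circ> circlepath z r) (f z) = winding_number (\<lambda>t. f z + u z * (circlepath z r t - z) ^ n) (f z)"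
  proof (rule winding_number_nearby_loops_eq)
    have sub: "path_image (circlepath z r) \<subseteq> S"
      using r r2 by (auto simp: dist_commute subset_iff)
    have "continuous_on S (\<lambda>w. h w + cnj (g w))"
      using hol by (intro continuous_intros holomorphic_on_imp_continuous_on)
    then have "continuous_on S f" by (rule continuous_on_eq) (simp add: f)
    then show "path (f \<circ> circlepath z r)"
      using sub by (intro path_continuous_image) (auto intro: continuous_on_subset)
    show "path (\<lambda>t. f z + u z * (circlepath z r t - z) ^ n)"
      unfolding path_def circlepath by (intro continuous_intros)
    have "circlepath z r 1 = circlepath z r 0" by (simp add: circlepath)
    then show "pathfinish (f \<circ> circlepath z r) = pathstart (f \<circ> circlepath z r)"
      "pathfinish (\<lambda>t. f z + u z * (circlepath z r t - z) ^ n)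
        = pathstart (\<lambda>t. f z + u z * (circlepath z r t - z) ^ n)"
      by (simp_all add: pathfinish_def pathstart_def)
    fix t :: real assume t: "t \<in> {0..1}"
    define w where "w = circlepath z r t"
    have w: "dist w z = r" "w \<in> S"
      using t sub r by (auto simp: w_def circlepath dist_norm norm_mult path_image_def)
    then have wz: "w \<noteq> z" "w \<in> ball z r1" using r by (auto simp: dist_commute)
    have "f w - f z - u z * (w - z) ^ n = (w - z) ^ n * (u w - u z) + cnj (g w - g z)"
      using f[OF w(2)] f[OF \<open>z \<in> S\<close>] u[OF wz(2)] by (simp add: algebra_simps)
    then have "cmod (f w - f z - u z * (w - z) ^ n) \<le> cmod (w - z) ^ n * cmod (u w - u z) + cmod (g w - g z)"
      by (metis complex_mod_cnj norm_mult norm_power norm_triangle_ineq)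
    also have "\<dots> \<le> cmod (w - z) ^ n * e + k * B * cmod (w - z) ^ n"
      using r4(2)[of w] dg[of w] w r by (intro add_mono mult_left_mono) (auto simp: dist_norm)
    also have "\<dots> = cmod (w - z) ^ n * (e + k * B)" by (simp add: algebra_simps)
    also have "\<dots> < cmod (w - z) ^ n * cmod (u z)"
    proof (rule mult_strict_left_mono)
      have "k * e \<le> e" using k e by (simp add: mult_le_cancel_right1)
      moreover have "3 * e = cmod (u z) - k * cmod (u z)" by (simp add: e_def left_diff_distrib)
      ultimately show "e + k * B < cmod (u z)" using e unfolding B_def distrib_left by linarith
    qed (use wz in auto)
    finally show "cmod ((f \<circ> circlepath z r) t - (f z + u z * (circlepath z r t - z) ^ n))
        < cmod (f z + u z * (circlepath z r t - z) ^ n - f z)"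
      by (simp add: w_def norm_mult norm_power mult_ac algebra_simps)
  qed
  also have "\<dots> = of_nat n"
    using une[of z] r1 r by (intro winding_number_power_circle) auto
  finally have wn: "winding_number (f \<circ> circlepath z r) (f z) = of_nat n" .
  have "cball z r \<subseteq> S" using r r2 by (auto simp: subset_iff)
  then have "winding_number (f \<circ> circlepath z r) (f z) = 1"
    using sp r unfolding sense_preserving_on_def by blast
  with wn have "of_nat n = (1::complex)" by simp
  then have "n = 1" by (metis of_nat_1 of_nat_eq_iff)
  with n show ?thesis by simp
qed

section \<open>Inverse branches and the distance to the boundary\<close>

text \<open>On a compact set the radius of injectivity (by a Lebesgue number) and the size of the discs covered
  by the image (by a positive minimum over spheres) can be chosen uniformly. This is what lets an
  inverse branch be continued by steps of fixed length.\<close>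
lemma uniform_local_inverse:
  assumes hol: "h holomorphic_on S" and S: "open S" and C: "compact C" "C \<subseteq> S" "C \<noteq> {}"
    and nz: "\<And>z. z \<in> S \<Longrightarrow> deriv h z \<noteq> 0"
  obtains \<eta> \<rho> where "\<eta> > 0" "\<rho> > 0" "\<And>c. c \<in> C \<Longrightarrow> ball c (2 * \<eta>) \<subseteq> S"
    "\<And>c. c \<in> C \<Longrightarrow> inj_on h (ball c (2 * \<eta>))"
    "\<And>c. c \<in> C \<Longrightarrow> ball (h c) \<rho> \<subseteq> h ` ball c \<eta>"
proof -
  define G where "G = {B. open B \<and> B \<subseteq> S \<and> inj_on h B}"
  have "C \<subseteq> \<Union> G"
  proof
    fix c assume "c \<in> C"
    then obtain r where "r > 0" "ball c r \<subseteq> S" "inj_on h (ball c r)"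
      using has_complex_derivative_locally_injective[OF hol _ S nz] C by blast
    then show "c \<in> \<Union> G" unfolding G_def by (auto intro!: exI[of _ "ball c r"])
  qed
  then obtain \<epsilon> where \<epsilon>: "\<epsilon> > 0" "\<And>x. x \<in> C \<Longrightarrow> \<exists>B\<in>G. ball x \<epsilon> \<subseteq> B"
    using Heine_Borel_lemma[OF C(1)] unfolding G_def by (metis (no_types, lifting) mem_Collect_eq)
  define \<eta> where "\<eta> = \<epsilon> / 2"
  have \<eta>: "\<eta> > 0" using \<epsilon> by (simp add: \<eta>_def)
  have sub: "ball c (2 * \<eta>) \<subseteq> S" and inj: "inj_on h (ball c (2 * \<eta>))" if "c \<in> C" for c
    using \<epsilon>(2)[OF that] unfolding G_def \<eta>_def by (auto intro: inj_on_subset)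
  have cb: "cball c \<eta> \<subseteq> ball c (2 * \<eta>)" for c :: complex using \<eta> by auto
  define F where "F = (\<lambda>p. norm (h (fst p + snd p) - h (fst p)))"
  have mem: "fst p + snd p \<in> cball (fst p) \<eta>" if "p \<in> C \<times> sphere 0 \<eta>" for p
    using that by (auto simp: dist_norm)
  have memS: "fst p + snd p \<in> S" if "p \<in> C \<times> sphere 0 \<eta>" for p
    using mem[OF that] cb sub that by (force simp: subset_iff)
  have conth: "continuous_on S h" using hol by (rule holomorphic_on_imp_continuous_on)
  have "continuous_on (C \<times> sphere 0 \<eta>) F"
    unfolding F_def
    by (intro continuous_intros continuous_on_compose2[OF conth]) (use C memS in auto)
  moreover have "C \<times> sphere (0::complex) \<eta> \<noteq> {}"
  proof -
    have "complex_of_real \<eta> \<in> sphere 0 \<eta>" using \<eta> by (simp add: dist_norm)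
    moreover obtain c where "c \<in> C" using C(3) by auto
    ultimately have "(c, complex_of_real \<eta>) \<in> C \<times> sphere 0 \<eta>" by (intro SigmaI)
    then show ?thesis by (metis empty_iff)
  qed
  ultimately have "\<exists>p\<in>C \<times> sphere 0 \<eta>. \<forall>q\<in>C \<times> sphere 0 \<eta>. F p \<le> F q"
    by (intro continuous_attains_inf compact_Times C(1) compact_sphere)
  then obtain p where p: "p \<in> C \<times> sphere 0 \<eta>" "\<And>q. q \<in> C \<times> sphere 0 \<eta> \<Longrightarrow> F p \<le> F q"
    by metis
  define \<rho> where "\<rho> = F p"
  have "\<rho> > 0"
  proof -
    have "fst p \<in> C" "norm (snd p) = \<eta>" using p by auto
    then have "h (fst p + snd p) \<noteq> h (fst p)"
      using inj[of "fst p"] mem[OF p(1)] cb[of "fst p"] \<eta>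
      by (auto dest!: inj_onD[where x = "fst p + snd p" and y = "fst p"])
    then show ?thesis by (simp add: \<rho>_def F_def)
  qed
  moreover have "ball (h c) \<rho> \<subseteq> h ` ball c \<eta>" if "c \<in> C" for c
  proof (rule ball_subset_open_map_image)
    have *: "cball c \<eta> \<subseteq> S" "ball c \<eta> \<subseteq> ball c (2 * \<eta>)" using cb sub[OF that] \<eta> by auto
    show "continuous_on (closure (ball c \<eta>)) h"
      using continuous_on_subset[OF conth] * \<eta> by simp
    show "open (h ` interior (ball c \<eta>))"
      using open_mapping_thm3[of h "ball c \<eta>"] * \<eta> inj[OF that] hol
      by (metis ball_subset_cball holomorphic_on_subset inj_on_subset interior_open open_ball order_trans)
    show "\<rho> \<le> norm (h z - h c)" if "z \<in> frontier (ball c \<eta>)" for z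
      using p(2)[of "(c, z - c)"] that \<open>c \<in> C\<close> \<eta>
      by (simp add: \<rho>_def F_def dist_norm norm_minus_commute)
  qed (use \<eta> \<open>\<rho> > 0\<close> in auto)
  ultimately show thesis using that \<eta> sub inj by blast
qed

text \<open>As \<open>h\<close> need not be injective, the value at \<open>h z\<close> is prescribed in order to single out one branch.\<close>
definition inverse_branch_on where
  "inverse_branch_on h S z B \<psi> \<longleftrightarrow> \<psi> holomorphic_on B \<and> (\<forall>w\<in>B. \<psi> w \<in> S \<and> h (\<psi> w) = w) \<and> \<psi> (h z) = z"

text \<open>Shrinking \<open>w\<close> radially into the smaller disc gives a point \<open>q w\<close> at distance less than \<open>\<rho>\<close> from \<open>w\<close>. Hence \<open>w\<close> has
  exactly one preimage near \<open>\<psi> (q w)\<close>, and choosing it defines the extension. Near each point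
  the choice agrees with a local inverse of \<open>h\<close>, so it is holomorphic. Continuing all
  radii at once in this way takes the place of a monodromy argument.\<close>
lemma inverse_branch_extend:
  assumes hol: "h holomorphic_on S" and S: "open S"
    and \<psi>: "inverse_branch_on h S z (ball (h z) r) \<psi>" and r: "r > 0"
    and \<eta>: "\<eta> > 0" and \<rho>: "\<rho> > 0"
    and C: "\<And>w. w \<in> ball (h z) r \<Longrightarrow> \<psi> w \<in> C"
    and sub: "\<And>c. c \<in> C \<Longrightarrow> ball c (2 * \<eta>) \<subseteq> S"
    and inj: "\<And>c. c \<in> C \<Longrightarrow> inj_on h (ball c (2 * \<eta>))"
    and surj: "\<And>c. c \<in> C \<Longrightarrow> ball (h c) \<rho> \<subseteq> h ` ball c \<eta>"
  shows "\<exists>\<phi>. inverse_branch_on h S z (ball (h z) (r + \<rho>)) \<phi>"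
proof -
  have hol\<psi>: "\<psi> holomorphic_on ball (h z) r"
    and inv: "\<And>w. w \<in> ball (h z) r \<Longrightarrow> h (\<psi> w) = w" and z: "\<psi> (h z) = z"
    using \<psi> by (auto simp: inverse_branch_on_def)
  define q where "q = (\<lambda>w. h z + of_real (r / (r + \<rho>)) * (w - h z))"
  have q: "q w \<in> ball (h z) r" "dist (q w) w < \<rho>" if "w \<in> ball (h z) (r + \<rho>)" for w
  proof -
    have d: "cmod (w - h z) < r + \<rho>" using that by (simp add: dist_norm norm_minus_commute)
    have "q w - h z = of_real (r / (r + \<rho>)) * (w - h z)" by (simp add: q_def)
    then have "cmod (q w - h z) = r / (r + \<rho>) * cmod (w - h z)"
      using r \<rho> by (simp only: norm_mult norm_of_real) simp
    also have "\<dots> < r / (r + \<rho>) * (r + \<rho>)" using d r \<rho> by (intro mult_strict_left_mono) auto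
    finally show "q w \<in> ball (h z) r" using r \<rho> by (simp add: dist_norm norm_minus_commute)
    have "r / (r + \<rho>) = 1 - \<rho> / (r + \<rho>)" using r \<rho> by (simp add: field_simps)
    then have "of_real (r / (r + \<rho>)) = (1 - of_real (\<rho> / (r + \<rho>)) :: complex)"
      by (simp only: of_real_diff of_real_1)
    moreover have "w - (h z + (1 - b) * (w - h z)) = b * (w - h z)" for b
      by (simp add: algebra_simps)
    ultimately have "w - q w = of_real (\<rho> / (r + \<rho>)) * (w - h z)"
      by (simp only: q_def)
    then have "cmod (w - q w) = \<rho> / (r + \<rho>) * cmod (w - h z)"
      using r \<rho> by (simp only: norm_mult norm_of_real) simp
    also have "\<dots> < \<rho> / (r + \<rho>) * (r + \<rho>)" using d r \<rho> by (intro mult_strict_left_mono) auto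
    finally show "dist (q w) w < \<rho>" using r \<rho> by (simp add: dist_norm norm_minus_commute)
  qed
  define P where "P = (\<lambda>w \<zeta>. \<zeta> \<in> ball (\<psi> (q w)) \<eta> \<and> h \<zeta> = w)"
  define \<phi> where "\<phi> = (\<lambda>w. SOME \<zeta>. P w \<zeta>)"
  have P: "P w (\<phi> w)" if "w \<in> ball (h z) (r + \<rho>)" for w
  proof -
    have "w \<in> ball (h (\<psi> (q w))) \<rho>" using q[OF that] inv by simp
    then have "\<exists>\<zeta>. P w \<zeta>" using surj[OF C[OF q(1)[OF that]]] unfolding P_def by blast
    then show ?thesis unfolding \<phi>_def by (rule someI_ex)
  qed
  have small: "ball c \<eta> \<subseteq> ball c (2 * \<eta>)" for c :: complex using \<eta> by auto
  have "inverse_branch_on h S z (ball (h z) (r + \<rho>)) \<phi>"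
    unfolding inverse_branch_on_def
  proof (intro conjI ballI)
    fix w assume w: "w \<in> ball (h z) (r + \<rho>)"
    show "h (\<phi> w) = w" using P[OF w] by (simp add: P_def)
    show "\<phi> w \<in> S" using P[OF w] sub[OF C[OF q(1)[OF w]]] small unfolding P_def by blast
  next
    have m: "h z \<in> ball (h z) (r + \<rho>)" "h z \<in> ball (h z) r" using r \<rho> by auto
    have "\<psi> (q (h z)) = z" using z by (simp add: q_def)
    then have "\<phi> (h z) \<in> ball z (2 * \<eta>)" "h (\<phi> (h z)) = h z" "z \<in> C"
      using P[OF m(1)] small[of z] C[OF m(2)] z unfolding P_def by auto
    then show "\<phi> (h z) = z" using inj[of z] \<eta> by (auto dest: inj_onD)
  next
    show "\<phi> holomorphic_on ball (h z) (r + \<rho>)"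
    proof (rule holomorphic_onI)
      fix w1 assume w1: "w1 \<in> ball (h z) (r + \<rho>)"
      define c where "c = \<psi> (q w1)"
      have cC: "c \<in> C" using C q w1 by (simp add: c_def)
      have holb: "h holomorphic_on ball c (2 * \<eta>)" using hol sub[OF cC] holomorphic_on_subset by blast
      obtain L where L: "L holomorphic_on h ` ball c (2 * \<eta>)"
          "\<And>\<zeta>. \<zeta> \<in> ball c (2 * \<eta>) \<Longrightarrow> L (h \<zeta>) = \<zeta>"
        by (rule holomorphic_has_inverse[OF holb open_ball inj[OF cC]]) (rule that)
      have opL: "open (h ` ball c (2 * \<eta>))" by (rule open_mapping_thm3[OF holb open_ball inj[OF cC]])
      have contq0: "continuous_on (ball (h z) (r + \<rho>)) q" unfolding q_def
        by (intro continuous_on_add continuous_on_mult continuous_on_diff continuous_on_const continuous_on_id)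
      have contq: "continuous_on (ball (h z) (r + \<rho>)) (\<lambda>w. \<psi> (q w))"
        by (rule continuous_on_compose2[OF holomorphic_on_imp_continuous_on[OF hol\<psi>]])
          (use q(1) contq0 in auto)
      define U where "U = ball (h z) (r + \<rho>) \<inter> (\<lambda>w. \<psi> (q w)) -` ball c \<eta>"
      have "open U" unfolding U_def by (rule continuous_open_preimage[OF contq]) auto
      moreover have "w1 \<in> U" using w1 \<eta> by (simp add: U_def c_def)
      moreover have eq: "L w = \<phi> w \<and> w \<in> h ` ball c (2 * \<eta>)" if "w \<in> U" for w
      proof -
        have "dist c (\<psi> (q w)) < \<eta>" "dist (\<psi> (q w)) (\<phi> w) < \<eta>" "h (\<phi> w) = w"
          using that P[of w] by (auto simp: U_def P_def)
        then have "\<phi> w \<in> ball c (2 * \<eta>)" using dist_triangle_less_add[of c "\<psi> (q w)" \<eta> "\<phi> w" \<eta>]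
          by (simp add: dist_commute)
        then show ?thesis using L(2) \<open>h (\<phi> w) = w\<close> by (metis imageI)
      qed
      ultimately have "(\<phi> has_field_derivative deriv L w1) (at w1)"
        using has_field_derivative_transform_within_open[OF holomorphic_derivI[OF L(1) opL]] by blast
      then show "\<phi> field_differentiable at w1 within ball (h z) (r + \<rho>)"
        using field_differentiable_at_within field_differentiable_def by blast
    qed
  qed
  then show ?thesis by blast
qed

text \<open>The Schwarz--Pick inequality at the centre of a disc of arbitrary radius: rescale to the unit disk
  and send \<open>\<psi> w0\<close> to \<open>0\<close> by a Moebius map.\<close>
lemma schwarz_pick_inverse:
  assumes "\<psi> holomorphic_on ball w0 r" "r > 0" "\<And>w. w \<in> ball w0 r \<Longrightarrow> \<psi> w \<in> ball 0 1"
  shows "r * cmod (deriv \<psi> w0) \<le> 1 - (cmod (\<psi> w0))\<^sup>2"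
proof -
  define z where "z = \<psi> w0"
  have z: "cmod z < 1" using assms by (auto simp: z_def)
  define F where "F = (\<lambda>\<zeta>. Moebius_function 0 z (\<psi> (w0 + of_real r * \<zeta>)))"
  have m: "w0 + of_real r * \<zeta> \<in> ball w0 r" if "cmod \<zeta> < 1" for \<zeta>
    using that assms(2) by (simp add: dist_norm norm_mult)
  have "F holomorphic_on ball 0 1"
    unfolding F_def
  proof (rule holomorphic_on_compose_gen[unfolded o_def, OF _ Moebius_function_holomorphic[OF z]])
    show "(\<lambda>\<zeta>. \<psi> (w0 + of_real r * \<zeta>)) holomorphic_on ball 0 1"
      by (rule holomorphic_on_compose_gen[unfolded o_def, OF _ assms(1)])
        (use m in \<open>auto intro!: holomorphic_intros\<close>)
  qed (use m assms(3) in auto)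
  moreover have "F 0 = 0" by (simp add: F_def z_def Moebius_function_eq_zero)
  moreover have "cmod (F \<zeta>) < 1" if "cmod \<zeta> < 1" for \<zeta>
    using Moebius_function_norm_lt_1[OF z] assms(3)[OF m[OF that]] by (simp add: F_def)
  ultimately have le: "cmod (deriv F 0) \<le> 1" using Schwarz_Lemma(2)[of F 0] by simp
  have nz: "1 - cnj z * z \<noteq> 0"
  proof
    assume "1 - cnj z * z = 0"
    then have "cmod (cnj z * z) = 1" by (metis eq_iff_diff_eq_0 norm_one)
    with z show False by (simp add: norm_mult abs_square_eq_1 flip: power2_eq_square)
  qed
  have 1: "((\<lambda>\<zeta>. \<psi> (w0 + of_real r * \<zeta>)) has_field_derivative deriv \<psi> w0 * of_real r) (at 0)"
    by (rule DERIV_chain2) (use holomorphic_derivI[OF assms(1), of w0] assms(2) in \<open>auto intro!: derivative_eq_intros\<close>)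
  have 2: "(Moebius_function 0 z has_field_derivative 1 / (1 - cnj z * z)) (at z)"
    unfolding Moebius_function_simple[abs_def]
    by (rule derivative_eq_intros refl nz | simp add: nz)+
  have "(F has_field_derivative 1 / (1 - cnj z * z) * (deriv \<psi> w0 * of_real r)) (at 0)"
    unfolding F_def by (rule DERIV_chain2[OF _ 1]) (use 2 in \<open>simp add: z_def\<close>)
  then have "deriv F 0 = deriv \<psi> w0 * of_real r / (1 - cnj z * z)"
    using DERIV_imp_deriv by fastforce
  moreover have "1 - cnj z * z = of_real (1 - (cmod z)\<^sup>2)"
    using complex_norm_square[of z] by (simp add: mult.commute)
  moreover have "1 - (cmod z)\<^sup>2 > 0" using z by (simp add: abs_square_less_1)
  ultimately have "cmod (deriv \<psi> w0) * r / (1 - (cmod z)\<^sup>2) \<le> 1"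
    using le assms(2) by (simp add: norm_mult norm_divide del: of_real_diff)
  then show ?thesis using \<open>1 - (cmod z)\<^sup>2 > 0\<close> by (simp add: z_def mult.commute)
qed

text \<open>For conformal maps this is the Schwarz lemma for the inverse map. Here \<open>f\<close> has no holomorphic
  inverse, but its analytic part \<open>h\<close> has an inverse branch \<open>\<psi>\<close> on every disc about \<open>h z\<close> of radius
  below \<open>d / 2\<close>: since \<open>\<bar>g'\<bar> \<le> \<bar>h'\<bar>\<close>, moving by \<open>t\<close> in the \<open>h\<close>-plane moves \<open>f \<circ> \<psi>\<close> by at most \<open>2 * t\<close>,
  so the continuation stays in a compact part of the disk and never stops before that radius.
  The Schwarz--Pick inequality for \<open>\<psi>\<close> bounds \<open>1 / \<bar>h' z\<bar>\<close>.\<close>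
lemma harmonic_koebe_upper:
  fixes f h g k :: "complex \<Rightarrow> complex"
  assumes hol: "h holomorphic_on \<D>" "g holomorphic_on \<D>"
    and f: "\<And>w. w \<in> \<D> \<Longrightarrow> f w = h w + cnj (g w)"
    and nz: "\<And>w. w \<in> \<D> \<Longrightarrow> deriv h w \<noteq> 0"
    and le: "\<And>w. w \<in> \<D> \<Longrightarrow> cmod (deriv g w) \<le> cmod (deriv h w)"
    and homeo: "homeomorphism \<D> (f ` \<D>) f k"
    and z: "z \<in> \<D>" and d: "ball (f z) d \<subseteq> f ` \<D>"
  shows "d \<le> 2 * (1 - (cmod z)\<^sup>2) * cmod (deriv h z)"
proof (rule ccontr)
  assume neg: "\<not> d \<le> 2 * (1 - (cmod z)\<^sup>2) * cmod (deriv h z)"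
  define s where "s = (1 - (cmod z)\<^sup>2) * cmod (deriv h z)"
  have "s > 0" using z nz[OF z] by (simp add: s_def abs_square_less_1)
  \<comment> \<open>Strictly between s and d / 2, so that the branch is continued beyond the radius that the
    Schwarz--Pick inequality permits.\<close>
  define r' where "r' = (s + d / 2) / 2"
  have "2 * s < d" using neg by (simp only: s_def not_le mult.assoc)
  then have r': "s < r'" "2 * r' < d" "r' > 0" using \<open>s > 0\<close> by (simp_all add: r'_def)
  define C where "C = k ` cball (f z) (2 * r')"
  have cb: "cball (f z) (2 * r') \<subseteq> f ` \<D>" using d r' by (auto simp: subset_iff)
  have C: "compact C" "C \<subseteq> \<D>" "C \<noteq> {}"
    using homeo cb r' unfolding C_def homeomorphism_def
    by (auto intro!: compact_continuous_image intro: continuous_on_subset)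
  obtain \<eta> \<rho> where \<eta>: "\<eta> > 0" and \<rho>: "\<rho> > 0" and sub: "\<And>c. c \<in> C \<Longrightarrow> ball c (2 * \<eta>) \<subseteq> \<D>"
    and inj: "\<And>c. c \<in> C \<Longrightarrow> inj_on h (ball c (2 * \<eta>))"
    and surj: "\<And>c. c \<in> C \<Longrightarrow> ball (h c) \<rho> \<subseteq> h ` ball c \<eta>"
    by (rule uniform_local_inverse[OF hol(1) open_ball C nz]) auto
  define P where "P r \<longleftrightarrow> (\<exists>\<psi>. inverse_branch_on h \<D> z (ball (h z) r) \<psi>)" for r
  have P_mono: "P r \<Longrightarrow> t \<le> r \<Longrightarrow> P t" for r t
    unfolding P_def inverse_branch_on_def
    by (meson holomorphic_on_subset subset_ball subsetD)
  have der\<psi>: "deriv h (\<psi> w) * deriv \<psi> w = 1"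
    if "inverse_branch_on h \<D> z (ball (h z) r) \<psi>" "w \<in> ball (h z) r" for r \<psi> w
  proof -
    have hol\<psi>: "\<psi> holomorphic_on ball (h z) r" and inv: "\<And>w. w \<in> ball (h z) r \<Longrightarrow> \<psi> w \<in> \<D> \<and> h (\<psi> w) = w"
      using that by (auto simp: inverse_branch_on_def)
    have "((\<lambda>w. h (\<psi> w)) has_field_derivative deriv h (\<psi> w) * deriv \<psi> w) (at w)"
      by (rule DERIV_chain2[OF holomorphic_derivI[OF hol(1)] holomorphic_derivI[OF hol\<psi>]])
        (use that inv in auto)
    then have "((\<lambda>w. w) has_field_derivative deriv h (\<psi> w) * deriv \<psi> w) (at w)"
      by (rule has_field_derivative_transform_within_open[OF _ open_ball]) (use that inv in auto)
    then show ?thesis using DERIV_unique DERIV_ident by blast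
  qed
  \<comment> \<open>A priori control: the branch cannot leave the compact set C while the radius is at most r'.\<close>
  have inC: "\<psi> w \<in> C"
    if \<psi>: "inverse_branch_on h \<D> z (ball (h z) r) \<psi>" and w: "w \<in> ball (h z) r" and "r \<le> r'" for r \<psi> w
  proof -
    have hol\<psi>: "\<psi> holomorphic_on ball (h z) r" and \<psi>z: "\<psi> (h z) = z"
      and inv: "\<And>w. w \<in> ball (h z) r \<Longrightarrow> \<psi> w \<in> \<D> \<and> h (\<psi> w) = w"
      using \<psi> by (auto simp: inverse_branch_on_def)
    have "norm (g (\<psi> w) - g (\<psi> (h z))) \<le> 1 * norm (w - h z)"
    proof (rule field_differentiable_bound[OF convex_ball])
      fix v assume v: "v \<in> ball (h z) r"
      have "((\<lambda>w. g (\<psi> w)) has_field_derivative deriv g (\<psi> v) * deriv \<psi> v) (at v)"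
        by (rule DERIV_chain2[OF holomorphic_derivI[OF hol(2)] holomorphic_derivI[OF hol\<psi>]])
          (use v inv in auto)
      then show "((\<lambda>w. g (\<psi> w)) has_field_derivative deriv g (\<psi> v) * deriv \<psi> v) (at v within ball (h z) r)"
        by (rule DERIV_subset) simp
      have "cmod (deriv g (\<psi> v)) * cmod (deriv \<psi> v) \<le> cmod (deriv h (\<psi> v)) * cmod (deriv \<psi> v)"
        using le inv[OF v] by (intro mult_right_mono) auto
      also have "\<dots> = 1" using der\<psi>[OF \<psi> v] by (metis norm_mult norm_one)
      finally show "norm (deriv g (\<psi> v) * deriv \<psi> v) \<le> 1" by (simp add: norm_mult)
    qed (use w in \<open>auto intro: le_less_trans[OF zero_le_dist]\<close>)
    then have "cmod (g (\<psi> w) - g z) \<le> cmod (w - h z)" using \<psi>z by simp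
    moreover have "f (\<psi> w) - f z = (w - h z) + cnj (g (\<psi> w) - g z)"
      using inv[OF w] f z by simp
    ultimately have "cmod (f (\<psi> w) - f z) \<le> cmod (w - h z) + cmod (w - h z)"
      by (metis add_mono_thms_linordered_semiring(2) complex_mod_cnj norm_triangle_le)
    also have "\<dots> \<le> 2 * r'" using w \<open>r \<le> r'\<close> by (simp add: dist_norm norm_minus_commute)
    finally have "f (\<psi> w) \<in> cball (f z) (2 * r')" by (simp add: dist_norm norm_minus_commute)
    moreover have "\<psi> w = k (f (\<psi> w))" using homeo inv[OF w] by (simp add: homeomorphism_def)
    ultimately show ?thesis unfolding C_def by blast
  qed
  have "z \<in> C" using homeo z r' unfolding C_def homeomorphism_def by (auto intro!: image_eqI[of _ k "f z"])
  have "P \<rho>"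
  proof -
    have h\<eta>: "h holomorphic_on ball z (2 * \<eta>)" using hol sub[OF \<open>z \<in> C\<close>] holomorphic_on_subset by blast
    obtain L where L: "L holomorphic_on h ` ball z (2 * \<eta>)"
        "\<And>\<zeta>. \<zeta> \<in> ball z (2 * \<eta>) \<Longrightarrow> L (h \<zeta>) = \<zeta>"
      by (rule holomorphic_has_inverse[OF h\<eta> open_ball inj[OF \<open>z \<in> C\<close>]]) (rule that)
    have *: "ball z \<eta> \<subseteq> ball z (2 * \<eta>)" using \<eta> by auto
    with surj[OF \<open>z \<in> C\<close>] have "ball (h z) \<rho> \<subseteq> h ` ball z (2 * \<eta>)" by blast
    then have "inverse_branch_on h \<D> z (ball (h z) \<rho>) L"
      unfolding inverse_branch_on_def
      using L sub[OF \<open>z \<in> C\<close>] \<eta> holomorphic_on_subset[OF L(1)] by (auto simp: subset_iff image_iff)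
    then show "P \<rho>" unfolding P_def by blast
  qed
  have step: "P (r + \<rho>)" if "P r" "0 < r" "r \<le> r'" for r
  proof -
    obtain \<psi> where \<psi>: "inverse_branch_on h \<D> z (ball (h z) r) \<psi>" using \<open>P r\<close> P_def by blast
    show ?thesis unfolding P_def
      by (rule inverse_branch_extend[OF hol(1) open_ball \<psi> \<open>0 < r\<close> \<eta> \<rho> inC[OF \<psi> _ \<open>r \<le> r'\<close>] sub inj surj])
  qed
  have "P (min r' (real (Suc n) * \<rho>))" for n
  proof (induction n)
    case 0
    then show ?case using P_mono[OF \<open>P \<rho>\<close>] by simp
  next
    case (Suc n)
    have "P (min r' (real (Suc n) * \<rho>) + \<rho>)" using Suc r' \<rho> by (intro step) auto
    then show ?case using \<rho> by (elim P_mono) (auto simp: min_def algebra_simps)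
  qed
  moreover obtain n where "r' < real n * \<rho>" using reals_Archimedean3[OF \<rho>] by blast
  then have "r' \<le> real (Suc n) * \<rho>" using \<rho> by (simp add: algebra_simps)
  ultimately have "P r'" by (metis min.absorb1)
  then obtain \<psi> where \<psi>: "inverse_branch_on h \<D> z (ball (h z) r') \<psi>" using P_def by blast
  have "r' * cmod (deriv \<psi> (h z)) \<le> 1 - (cmod (\<psi> (h z)))\<^sup>2"
    using \<psi> r' by (intro schwarz_pick_inverse) (auto simp: inverse_branch_on_def)
  moreover have "\<psi> (h z) = z" using \<psi> by (simp add: inverse_branch_on_def)
  moreover have "cmod (deriv h z) * cmod (deriv \<psi> (h z)) = 1"
    using der\<psi>[OF \<psi>, of "h z"] r' \<open>\<psi> (h z) = z\<close> by (metis centre_in_ball norm_mult norm_one)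
  moreover have "r' = r' * cmod (deriv \<psi> (h z)) * cmod (deriv h z)"
    using calculation(3) by (simp add: mult.assoc mult.commute)
  ultimately have "r' \<le> s"
    unfolding s_def by (metis mult_right_mono norm_ge_zero)
  then show False using r' by simp
qed

lemma ball_boundary_dist_subset:
  assumes "w \<in> \<Omega>"
  shows "ball w (boundary_dist \<Omega> w) \<subseteq> \<Omega>"
proof (rule ccontr)
  assume "\<not> ?thesis"
  then obtain p where p: "p \<in> ball w (boundary_dist \<Omega> w)" "p \<notin> \<Omega>" by blast
  have "w \<in> ball w (boundary_dist \<Omega> w)" using p by (auto intro: le_less_trans[OF zero_le_dist])
  then have "ball w (boundary_dist \<Omega> w) \<inter> frontier \<Omega> \<noteq> {}"
    using p assms connected_Int_frontier[OF connected_ball, of w "boundary_dist \<Omega> w" \<Omega>] by blast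
  then obtain b where "b \<in> frontier \<Omega>" "dist w b < boundary_dist \<Omega> w" by auto
  then show False using infdist_le[of b "frontier \<Omega>" w] by (simp add: boundary_dist_def)
qed

section \<open>Displacement within a Carleson box\<close>

lemma polar_mem_carleson_box:
  assumes "0 < \<rho>" "\<rho> \<le> r" "r < 1" "\<bar>u\<bar> \<le> pi * (1 - \<rho>)"
  shows "of_real r * cis (\<theta> + u) \<in> carleson_box (of_real \<rho> * cis \<theta>)"
proof -
  have "pi * (1 - \<rho>) < pi" using assms by simp
  then have u: "-pi < -u" "-u \<le> pi" using assms by linarith+
  have "of_real \<rho> * cis \<theta> / (of_real r * cis (\<theta> + u)) = of_real (\<rho> / r) * cis (- u)"
    by (simp add: field_simps flip: cis_mult cis_inverse)
  then have "Arg (of_real \<rho> * cis \<theta> / (of_real r * cis (\<theta> + u))) = - u"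
    using assms u by (intro cis_Arg_unique) (simp_all add: sgn_eq norm_mult norm_divide)
  then show ?thesis using assms by (simp add: carleson_box_def norm_mult)
qed

lemma harmonic_along_curve:
  assumes hol: "h holomorphic_on \<D>" "g holomorphic_on \<D>"
    and \<gamma>: "(\<gamma> has_vector_derivative v) (at t)" "\<gamma> t \<in> \<D>"
  shows "((\<lambda>s. h (\<gamma> s) + cnj (g (\<gamma> s))) has_vector_derivative
      v * deriv h (\<gamma> t) + cnj (v * deriv g (\<gamma> t))) (at t)"
    and "cmod (v * deriv h (\<gamma> t) + cnj (v * deriv g (\<gamma> t)))
      \<le> cmod v * (cmod (deriv h (\<gamma> t)) + cmod (deriv g (\<gamma> t)))"
proof -
  have "((h \<circ> \<gamma>) has_vector_derivative v * deriv h (\<gamma> t)) (at t)"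
    "((g \<circ> \<gamma>) has_vector_derivative v * deriv g (\<gamma> t)) (at t)"
    by (rule field_vector_diff_chain_at[OF \<gamma>(1)]; use hol \<gamma>(2) in \<open>auto intro: holomorphic_derivI\<close>)+
  then show "((\<lambda>s. h (\<gamma> s) + cnj (g (\<gamma> s))) has_vector_derivative
      v * deriv h (\<gamma> t) + cnj (v * deriv g (\<gamma> t))) (at t)"
    by (intro derivative_intros) (auto simp: o_def)
  show "cmod (v * deriv h (\<gamma> t) + cnj (v * deriv g (\<gamma> t)))
      \<le> cmod v * (cmod (deriv h (\<gamma> t)) + cmod (deriv g (\<gamma> t)))"
    by (rule norm_triangle_le) (simp only: complex_mod_cnj norm_mult distrib_left)
qed

text \<open>Travel from \<open>z\<close> along the circle and then outwards. The arc has length at most \<open>\<pi> * (1 - \<rho>)\<close>;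
  on the radius the bound on the derivative is integrable because its exponent \<open>\<delta> - 1\<close> exceeds \<open>-1\<close>,
  and contributes \<open>(1 - \<rho>) / \<delta>\<close>.\<close>
lemma displacement_of_derivative_growth:
  assumes hol: "h holomorphic_on \<D>" "g holomorphic_on \<D>"
    and \<delta>: "0 < \<delta>" and M: "M \<ge> 0"
    and D: "\<And>w. D w = cmod (deriv h w) + cmod (deriv g w)"
    and z: "z = of_real \<rho> * cis \<theta>" "0 < \<rho>" "\<rho> < 1"
    and growth: "\<And>\<zeta>. \<zeta> \<in> carleson_box z \<Longrightarrow> D \<zeta> \<le> M * D z * ((1 - cmod \<zeta>) / (1 - cmod z)) powr (\<delta> - 1)"
    and r: "\<rho> \<le> r" "r < 1" and u: "\<bar>u\<bar> \<le> pi * (1 - \<rho>)"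
    and F: "\<And>w. F w = h w + cnj (g w)"
  shows "cmod (F (of_real r * cis (\<theta> + u)) - F z) \<le> M * (pi + 1 / \<delta>) * (1 - \<rho>) * D z"
proof -
  define s where "s = 1 - \<rho>"
  have s: "s > 0" using z by (simp add: s_def)
  have Dz: "D z \<ge> 0" by (simp add: D)
  have growth': "D (of_real t * cis (\<theta> + v)) \<le> M * D z * ((1 - t) / s) powr (\<delta> - 1)"
    if "\<rho> \<le> t" "t < 1" "\<bar>v\<bar> \<le> pi * (1 - \<rho>)" for t v
    using growth[of "of_real t * cis (\<theta> + v)"] polar_mem_carleson_box[OF z(2) that] z that
    by (simp add: norm_mult s_def)
  have arc: "cmod (F (of_real \<rho> * cis (\<theta> + u)) - F z) \<le> M * pi * s * D z"
  proof -
    define \<gamma> where "\<gamma> = (\<lambda>t::real. of_real \<rho> * cis (\<theta> + t * u))"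
    have \<gamma>: "(\<gamma> has_vector_derivative of_real \<rho> * (\<i> * of_real u * cis (\<theta> + t * u))) (at t)" for t
    proof -
      have \<gamma>_exp: "\<gamma> = (\<lambda>t. of_real \<rho> * exp (\<i> * (of_real \<theta> + of_real t * of_real u)))"
        by (simp add: \<gamma>_def cis_conv_exp)
      have "((\<lambda>w. of_real \<rho> * exp (\<i> * (of_real \<theta> + w * of_real u))) has_field_derivative
          of_real \<rho> * (\<i> * of_real u * cis (\<theta> + t * u))) (at (of_real t))"
        by (auto intro!: derivative_eq_intros simp: cis_conv_exp)
      from has_vector_derivative_real_field[OF this] show ?thesis by (simp only: \<gamma>_exp)
    qed
    have m: "\<gamma> t \<in> \<D>" for t using z by (simp add: \<gamma>_def norm_mult)
    have "norm ((\<lambda>t. h (\<gamma> t) + cnj (g (\<gamma> t))) 1 - (\<lambda>t. h (\<gamma> t) + cnj (g (\<gamma> t))) 0)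
        \<le> (\<lambda>t. M * pi * s * D z * t) 1 - (\<lambda>t. M * pi * s * D z * t) 0"
    proof (rule differentiable_bound_general)
      show "continuous_on {0..1} (\<lambda>t. h (\<gamma> t) + cnj (g (\<gamma> t)))"
        by (rule continuous_at_imp_continuous_on)
          (use has_vector_derivative_continuous[OF harmonic_along_curve(1)[OF hol \<gamma> m]] in auto)
      show "((\<lambda>t. h (\<gamma> t) + cnj (g (\<gamma> t))) has_vector_derivative
          of_real \<rho> * (\<i> * of_real u * cis (\<theta> + t * u)) * deriv h (\<gamma> t) +
          cnj (of_real \<rho> * (\<i> * of_real u * cis (\<theta> + t * u)) * deriv g (\<gamma> t))) (at t)" for t
        by (rule harmonic_along_curve(1)[OF hol \<gamma> m])
      show "((\<lambda>t. M * pi * s * D z * t) has_vector_derivative M * pi * s * D z) (at t)" for t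
        by (auto intro!: derivative_eq_intros simp flip: has_real_derivative_iff_has_vector_derivative)
      fix t :: real assume t: "0 < t" "t < 1"
      have "\<bar>t * u\<bar> \<le> 1 * \<bar>u\<bar>" unfolding abs_mult using t by (intro mult_right_mono) auto
      then have "D (\<gamma> t) \<le> M * D z"
        using growth'[of \<rho> "t * u"] u z s by (simp add: \<gamma>_def s_def)
      then have "\<rho> * \<bar>u\<bar> * D (\<gamma> t) \<le> 1 * (pi * s) * (M * D z)"
        using z u s M Dz by (intro mult_mono) (auto simp: s_def D)
      then show "norm (of_real \<rho> * (\<i> * of_real u * cis (\<theta> + t * u)) * deriv h (\<gamma> t) +
          cnj (of_real \<rho> * (\<i> * of_real u * cis (\<theta> + t * u)) * deriv g (\<gamma> t))) \<le> M * pi * s * D z"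
        using harmonic_along_curve(2)[OF hol \<gamma> m, of t] z
        by (simp add: norm_mult D mult_ac)
    qed (auto intro!: continuous_intros)
    then show ?thesis by (simp add: \<gamma>_def F z)
  qed
  have radial: "cmod (F (of_real r * cis (\<theta> + u)) - F (of_real \<rho> * cis (\<theta> + u))) \<le> M * (1 / \<delta>) * s * D z"
  proof (cases "r = \<rho>")
    case False
    define \<gamma> where "\<gamma> = (\<lambda>t::real. of_real t * cis (\<theta> + u))"
    have \<gamma>: "(\<gamma> has_vector_derivative cis (\<theta> + u)) (at t)" for t
      unfolding \<gamma>_def by (auto intro!: derivative_eq_intros)
    define \<phi> where "\<phi> = (\<lambda>t. - (M * D z * s / \<delta>) * ((1 - t) / s) powr \<delta>)"
    have m: "\<gamma> t \<in> \<D>" if "\<rho> \<le> t" "t \<le> r" for t using z r that by (simp add: \<gamma>_def norm_mult)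
    have d\<phi>: "(\<phi> has_real_derivative M * D z * ((1 - t) / s) powr (\<delta> - 1)) (at t)" if "t \<le> r" for t
      unfolding \<phi>_def using that r s \<delta>
      by (auto intro!: derivative_eq_intros)
    have "norm ((\<lambda>t. h (\<gamma> t) + cnj (g (\<gamma> t))) r - (\<lambda>t. h (\<gamma> t) + cnj (g (\<gamma> t))) \<rho>) \<le> \<phi> r - \<phi> \<rho>"
    proof (rule differentiable_bound_general)
      show "continuous_on {\<rho>..r} (\<lambda>t. h (\<gamma> t) + cnj (g (\<gamma> t)))"
        by (rule continuous_at_imp_continuous_on)
          (use has_vector_derivative_continuous[OF harmonic_along_curve(1)[OF hol \<gamma> m]] in auto)
      show "continuous_on {\<rho>..r} \<phi>"
        by (rule continuous_at_imp_continuous_on) (use DERIV_isCont[OF d\<phi>] in auto)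
      show "((\<lambda>t. h (\<gamma> t) + cnj (g (\<gamma> t))) has_vector_derivative
          cis (\<theta> + u) * deriv h (\<gamma> t) + cnj (cis (\<theta> + u) * deriv g (\<gamma> t))) (at t)"
        if "\<rho> < t" "t < r" for t
        by (rule harmonic_along_curve(1)[OF hol \<gamma> m]) (use that in auto)
      show "(\<phi> has_vector_derivative M * D z * ((1 - t) / s) powr (\<delta> - 1)) (at t)" if "\<rho> < t" "t < r" for t
        using d\<phi>[of t] that by (simp add: has_real_derivative_iff_has_vector_derivative)
      show "norm (cis (\<theta> + u) * deriv h (\<gamma> t) + cnj (cis (\<theta> + u) * deriv g (\<gamma> t)))
          \<le> M * D z * ((1 - t) / s) powr (\<delta> - 1)" if "\<rho> < t" "t < r" for t
        using harmonic_along_curve(2)[OF hol \<gamma> m, of t] growth'[of t u] that r u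
        by (simp add: D \<gamma>_def)
    qed (use r False in auto)
    also have "\<phi> r - \<phi> \<rho> \<le> M * (1 / \<delta>) * s * D z"
    proof -
      have "0 \<le> M * D z * s / \<delta> * ((1 - r) / s) powr \<delta>" using M Dz s \<delta> by simp
      moreover have "\<phi> \<rho> = - (M * D z * s / \<delta>)" using s by (simp add: \<phi>_def flip: s_def)
      moreover have "\<phi> r = - (M * D z * s / \<delta> * ((1 - r) / s) powr \<delta>)" by (simp add: \<phi>_def)
      moreover have "M * (1 / \<delta>) * s * D z = M * D z * s / \<delta>" by simp
      ultimately show ?thesis by linarith
    qed
    finally show ?thesis by (simp add: \<gamma>_def F)
  qed (use M Dz s \<delta> in auto)
  have "cmod (F (of_real r * cis (\<theta> + u)) - F z) \<le> M * (1 / \<delta>) * s * D z + M * pi * s * D z"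
    using norm_triangle_mono[OF radial arc] by simp
  also have "\<dots> = M * (pi + 1 / \<delta>) * (1 - \<rho>) * D z"
    by (simp add: s_def algebra_simps)
  finally show ?thesis .
qed

section \<open>Area of the image of a polar rectangle\<close>

text \<open>The change of variables formula lives on \<open>real^2\<close>, iterated integrals on \<open>real \<times> real\<close>, and the
  maps on \<open>complex\<close>; the following identifications connect the three.\<close>
definition vec2 :: "real \<Rightarrow> real \<Rightarrow> real^2" where "vec2 x y = (\<chi> i. if i = 1 then x else y)"

lemma vec2_nth [simp]: "vec2 x y $ 1 = x" "vec2 x y $ 2 = y"
  by (simp_all add: vec2_def)

lemma has_integral_vec2:
  fixes f :: "real \<times> real \<Rightarrow> 'b::real_normed_vector"
  assumes "(f has_integral I) (cbox (a, c) (b, d))"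
  shows "((\<lambda>x::real^2. f (x $ 1, x $ 2)) has_integral I) (cbox (vec2 a c) (vec2 b d))"
proof -
  define g :: "real^2 \<Rightarrow> real \<times> real" where "g = (\<lambda>x. (x $ 1, x $ 2))"
  define k :: "real \<times> real \<Rightarrow> real^2" where "k = (\<lambda>p. vec2 (fst p) (snd p))"
  have kg: "k (g x) = x" for x by (simp add: k_def g_def vec_eq_iff forall_2)
  have gk: "g (k p) = p" for p by (simp add: k_def g_def)
  have mem: "g x \<in> cbox (g u) (g v) \<longleftrightarrow> x \<in> cbox u v" for x u v
    by (auto simp: g_def mem_box_cart forall_2 cbox_Pair_eq)
  have gim: "g ` cbox u v = cbox (g u) (g v)" for u v
  proof (intro equalityI subsetI)
    fix p assume "p \<in> cbox (g u) (g v)"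
    then have "k p \<in> cbox u v" using mem[of "k p" u v] gk by simp
    then show "p \<in> g ` cbox u v" using gk by (intro image_eqI[of p g "k p"]) auto
  qed (use mem in auto)
  have kim: "k ` cbox p q = cbox (k p) (k q)" for p q
  proof (intro equalityI subsetI)
    fix x assume "x \<in> cbox (k p) (k q)"
    then have "g x \<in> cbox p q" using mem[of x "k p" "k q"] gk by simp
    then show "x \<in> k ` cbox p q" using kg by (intro image_eqI[of x k "g x"]) auto
  next
    fix x assume "x \<in> k ` cbox p q"
    then show "x \<in> cbox (k p) (k q)" using mem[of x "k p" "k q"] gk by auto
  qed
  have ex2: "(\<exists>i::2. P i) \<longleftrightarrow> P 1 \<or> P 2" for P by (metis exhaust_2)
  have cont: "measure lborel (g ` cbox u v) = 1 * measure lborel (cbox u v)" for u v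
    unfolding gim unfolding g_def content_Pair content_cbox_if_cart content_real_if
    by (auto simp: UNIV_2 interval_eq_empty_cart ex2)
  have "((\<lambda>x. f (g x)) has_integral (1 / 1) *\<^sub>R I) (k ` cbox (a, c) (b, d))"
    by (rule has_integral_twiddle[OF _ kg gk _ _ _ cont assms])
      (use gim kim in \<open>auto simp: g_def intro!: continuous_intros\<close>)
  then show ?thesis by (simp add: kim) (simp add: g_def k_def)
qed


definition complex_to_vec2 :: "complex \<Rightarrow> real^2" where
  "complex_to_vec2 w = vec2 (Re w) (Im w)"

lemma bounded_linear_complex_to_vec2: "bounded_linear complex_to_vec2"
proof -
  have "linear complex_to_vec2"
    by (rule linearI) (auto simp: complex_to_vec2_def vec_eq_iff forall_2)
  then show ?thesis by (rule linear_conv_bounded_linear[THEN iffD1])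
qed

lemma dist_complex_to_vec2: "dist (complex_to_vec2 v) (complex_to_vec2 w) = dist v w"
  by (simp add: complex_to_vec2_def dist_vec_def L2_set_def UNIV_2 dist_complex_def cmod_def dist_real_def)

text \<open>The determinant with columns the radial and the angular derivative of a harmonic map, where \<open>A\<close> and
  \<open>B\<close> are the radial derivatives of its analytic and co-analytic parts.\<close>
lemma harmonic_jacobian:
  fixes A B :: complex
  shows "Re (A + cnj B) * Im (of_real r * (\<i> * A) + cnj (of_real r * (\<i> * B)))
    - Re (of_real r * (\<i> * A) + cnj (of_real r * (\<i> * B))) * Im (A + cnj B)
    = r * ((cmod A)\<^sup>2 - (cmod B)\<^sup>2)"
  unfolding cmod_power2 by (simp add: power2_eq_square algebra_simps)

text \<open>An injective map covers each point of its image once, so the integral of its Jacobian is the area of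
  an image contained in a disc of radius \<open>c\<close>. Using polar coordinates as part of the map yields the
  integral directly over a rectangle.\<close>
lemma polar_area_le:
  fixes h g :: "complex \<Rightarrow> complex" and \<theta> :: real
  defines "P \<equiv> \<lambda>p. of_real (fst p) * cis (\<theta> + snd p)"
  assumes hol: "h holomorphic_on ball 0 1" "g holomorphic_on ball 0 1"
    and le: "\<And>w. w \<in> ball 0 1 \<Longrightarrow> cmod (deriv g w) \<le> cmod (deriv h w)"
    and F: "\<And>w. F w = h w + cnj (g w)"
    and \<rho>: "0 < \<rho>" and R: "R < 1"
    and inj: "inj_on (F \<circ> P) (cbox (\<rho>, -\<alpha>) (R, \<alpha>))"
    and c: "0 \<le> c" "\<And>p. p \<in> cbox (\<rho>, -\<alpha>) (R, \<alpha>) \<Longrightarrow> cmod (F (P p) - w0) \<le> c"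
  shows "integral (cbox (\<rho>, -\<alpha>) (R, \<alpha>))
      (\<lambda>p. fst p * ((cmod (deriv h (P p)))\<^sup>2 - (cmod (deriv g (P p)))\<^sup>2)) \<le> pi * c\<^sup>2"
proof -
  define Q where "Q = cbox (\<rho>, -\<alpha>) (R, \<alpha>)"
  define S :: "(real^2) set" where "S = cbox (vec2 \<rho> (-\<alpha>)) (vec2 R \<alpha>)"
  define pr :: "real^2 \<Rightarrow> real \<times> real" where "pr = (\<lambda>x. (x $ 1, x $ 2))"
  define J where "J = (\<lambda>p. fst p * ((cmod (deriv h (P p)))\<^sup>2 - (cmod (deriv g (P p)))\<^sup>2))"
  define G where "G = (\<lambda>x. complex_to_vec2 (F (P (pr x))))"
  have prS: "pr x \<in> Q" if "x \<in> S" for x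
    using that by (auto simp: S_def Q_def pr_def mem_box_cart forall_2 cbox_Pair_eq)
  have inj_pr: "inj pr" by (rule injI) (auto simp: pr_def vec_eq_iff forall_2)
  have PD: "P p \<in> ball 0 1" if "p \<in> Q" for p
    using that \<rho> R by (auto simp: P_def Q_def cbox_Pair_eq norm_mult)
  have contP: "continuous_on Q P"
    unfolding P_def cis_conv_exp by (intro continuous_intros)
  have "continuous_on Q J"
    unfolding J_def
    by (intro continuous_intros continuous_on_compose2[OF holomorphic_on_imp_continuous_on[OF holomorphic_deriv] contP])
      (use hol PD in auto)
  then have "(J has_integral integral Q J) Q"
    unfolding Q_def by (intro integrable_integral integrable_continuous)
  then have intJ: "((\<lambda>x. J (pr x)) has_integral integral Q J) S"
    unfolding Q_def S_def pr_def by (rule has_integral_vec2)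
  define D where "D = (\<lambda>(x::real^2) (v::real^2). of_real (v $ 1) * cis (\<theta> + x $ 2) + of_real (x $ 1) * (\<i> * cis (\<theta> + x $ 2) * of_real (v $ 2)))"
  have vn: "((\<lambda>x::real^2. complex_of_real (x $ i)) has_derivative (\<lambda>v. of_real (v $ i))) (at x)" for i x
    by (rule bounded_linear_imp_has_derivative)
      (rule bounded_linear_compose[OF bounded_linear_of_real bounded_linear_vec_nth])
  have dP: "((\<lambda>x. P (pr x)) has_derivative D x) (at x)" for x
  proof -
    have "((\<lambda>w. exp (\<i> * (of_real \<theta> + w))) has_field_derivative \<i> * cis (\<theta> + x $ 2)) (at (of_real (x $ 2)))"
      by (auto intro!: derivative_eq_intros simp: cis_conv_exp)
    then have "((\<lambda>w. exp (\<i> * (of_real \<theta> + w))) has_derivative (\<lambda>w. \<i> * cis (\<theta> + x $ 2) * w)) (at (of_real (x $ 2)))"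
      by (rule has_field_derivative_imp_has_derivative)
    moreover have "((\<lambda>x::real^2. complex_of_real (x $ 2)) has_derivative (\<lambda>v. of_real (v $ 2))) (at x)"
      by (rule vn)
    ultimately have "((\<lambda>x::real^2. exp (\<i> * (of_real \<theta> + complex_of_real (x $ 2))))
        has_derivative (\<lambda>v. \<i> * cis (\<theta> + x $ 2) * of_real (v $ 2))) (at x)"
      using has_derivative_compose[where f = "\<lambda>x::real^2. complex_of_real (x $ 2)"] by blast
    then have "((\<lambda>x::real^2. cis (\<theta> + x $ 2)) has_derivative (\<lambda>v. \<i> * cis (\<theta> + x $ 2) * of_real (v $ 2))) (at x)"
      by (simp add: cis_conv_exp)
    from has_derivative_mult[OF vn this]
    show ?thesis
      unfolding P_def pr_def D_def by (simp add: add.commute)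
  qed
  define G' where "G' = (\<lambda>x v. complex_to_vec2 (deriv h (P (pr x)) * D x v + cnj (deriv g (P (pr x)) * D x v)))"
  have dG: "(G has_derivative G' x) (at x within S)" if "x \<in> S" for x
  proof -
    have der: "((\<lambda>x. k (P (pr x))) has_derivative (\<lambda>v. deriv k (P (pr x)) * D x v)) (at x)"
      if "k holomorphic_on ball 0 1" for k
      by (rule has_derivative_compose[OF dP has_field_derivative_imp_has_derivative])
        (use holomorphic_derivI[OF that] PD[OF prS[OF \<open>x \<in> S\<close>]] in auto)
    show ?thesis
      unfolding G_def G'_def F
      by (rule has_derivative_at_withinI, rule bounded_linear.has_derivative[OF bounded_linear_complex_to_vec2],
          rule has_derivative_add[OF der[OF hol(1)] bounded_linear.has_derivative[OF bounded_linear_cnj der[OF hol(2)]]])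
  qed
  have det: "\<bar>det (matrix (G' x))\<bar> = J (pr x)" if "x \<in> S" for x
  proof -
    define A B where "A = deriv h (P (pr x)) * cis (\<theta> + x $ 2)" and "B = deriv g (P (pr x)) * cis (\<theta> + x $ 2)"
    have "G' x (axis 1 1) = complex_to_vec2 (A + cnj B)"
      by (simp add: G'_def D_def A_def B_def axis_def)
    moreover have "G' x (axis 2 1) = complex_to_vec2 (of_real (x $ 1) * (\<i> * A) + cnj (of_real (x $ 1) * (\<i> * B)))"
      by (simp add: G'_def D_def A_def B_def axis_def mult_ac)
    ultimately have "det (matrix (G' x)) = x $ 1 * ((cmod A)\<^sup>2 - (cmod B)\<^sup>2)"
      unfolding harmonic_jacobian[symmetric] det_2 matrix_def
      by (simp only: vec_lambda_beta complex_to_vec2_def vec2_nth)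
    also have "\<dots> = J (pr x)" by (simp add: J_def pr_def A_def B_def norm_mult)
    finally have "det (matrix (G' x)) = J (pr x)" .
    moreover have "J (pr x) \<ge> 0"
      using le[OF PD[OF prS[OF that]]] prS[OF that] \<rho>
      by (auto simp: J_def Q_def pr_def cbox_Pair_eq intro!: mult_nonneg_nonneg power_mono)
    ultimately show ?thesis by simp
  qed
  have injG: "inj_on G S"
  proof (rule inj_onI)
    fix x y assume *: "x \<in> S" "y \<in> S" "G x = G y"
    then have "F (P (pr x)) = F (P (pr y))"
      unfolding G_def by (metis dist_complex_to_vec2 dist_eq_0_iff)
    then have "pr x = pr y" using inj_onD[OF inj] prS * unfolding Q_def by (metis comp_apply)
    then show "x = y" using inj_pr by (simp add: inj_eq)
  qed
  have S: "S \<in> sets lebesgue" unfolding S_def by simp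
  have int: "((\<lambda>x. \<bar>det (matrix (G' x))\<bar>) has_integral integral Q J) S"
    by (rule has_integral_eq[OF _ intJ]) (simp add: det)
  have "integral Q J = measure lebesgue (G ` S)"
    using measure_differentiable_image_eq[OF S dG injG] int by (simp add: has_integral_iff)
  also have "\<dots> \<le> measure lebesgue (cball (complex_to_vec2 w0) c)"
  proof (rule measure_mono_fmeasurable)
    show "G ` S \<subseteq> cball (complex_to_vec2 w0) c"
      using c(2)[OF prS[unfolded Q_def]] unfolding G_def
      by (auto simp: dist_complex_to_vec2 dist_complex_def norm_minus_commute)
    show "G ` S \<in> sets lebesgue"
      using measurable_differentiable_image_eq[OF S dG injG] int by (auto simp: has_integral_iff)
  qed simp
  also have "\<dots> = pi * c\<^sup>2"
    using content_cball[OF c(1), of "complex_to_vec2 w0"] by (simp add: unit_ball_vol_2)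
  finally show ?thesis by (simp add: Q_def J_def)
qed

section \<open>Mean squares over circles\<close>

lemma has_integral_cis_multiple:
  assumes "k \<noteq> 0"
  shows "((\<lambda>t. cis (of_int k * t)) has_integral 0) {0..2 * pi}"
proof -
  have "((\<lambda>t. cis (of_int k * t)) has_integral
      cis (of_int k * (2 * pi)) / (\<i> * of_int k) - cis (of_int k * 0) / (\<i> * of_int k)) {0..2 * pi}"
  proof (rule fundamental_theorem_of_calculus)
    fix t :: real
    have "((\<lambda>w. exp (\<i> * (of_int k * w)) / (\<i> * of_int k)) has_field_derivative exp (\<i> * (of_int k * of_real t))) (at (of_real t))"
      using assms by (auto intro!: derivative_eq_intros simp: mult_ac)
    from has_vector_derivative_real_field[OF this]
    have "((\<lambda>t. cis (of_int k * t) / (\<i> * of_int k)) has_vector_derivative cis (of_int k * t)) (at t)"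
      by (simp add: cis_conv_exp)
    then show "((\<lambda>t. cis (of_int k * t) / (\<i> * of_int k)) has_vector_derivative cis (of_int k * t)) (at t within {0..2 * pi})"
      by (rule has_vector_derivative_at_within)
  qed simp
  moreover have "cis (of_int k * (2 * pi)) = 1" using cis_multiple_2pi[of "of_int k"] by (simp add: mult_ac)
  ultimately show ?thesis by simp
qed

lemma trig_polynomial_parseval:
  fixes c :: "nat \<Rightarrow> complex"
  shows "((\<lambda>t. (cmod (\<Sum>n<N. c n * cis (real n * t)))\<^sup>2) has_integral 2 * pi * (\<Sum>n<N. (cmod (c n))\<^sup>2)) {0..2 * pi}"
proof (induction N)
  case (Suc N)
  define S where "S = (\<lambda>t. \<Sum>n<N. c n * cis (real n * t))"
  have "((\<lambda>t. \<Sum>n<N. (c n * cnj (c N)) * cis (of_int (int n - int N) * t)) has_integral (\<Sum>n<N. (c n * cnj (c N)) * 0)) {0..2 * pi}"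
    by (intro has_integral_sum has_integral_mult_right has_integral_cis_multiple) auto
  moreover have "cis (of_int (int n - int N) * t) = cis (real n * t) * cnj (cis (real N * t))" for n t
    by (simp add: cis_cnj cis_mult algebra_simps)
  then have "(\<Sum>n<N. (c n * cnj (c N)) * cis (of_int (int n - int N) * t)) = S t * cnj (c N * cis (real N * t))" for t
    by (simp add: S_def sum_distrib_left mult_ac)
  ultimately have "((\<lambda>t. S t * cnj (c N * cis (real N * t))) has_integral 0) {0..2 * pi}" by simp
  from has_integral_linear[OF this bounded_linear_Re]
  have cross: "((\<lambda>t. Re (S t * cnj (c N * cis (real N * t)))) has_integral 0) {0..2 * pi}"
    by (simp only: o_def zero_complex.simps)
  have "((\<lambda>t. (cmod (S t))\<^sup>2 + (cmod (c N))\<^sup>2 + 2 * Re (S t * cnj (c N * cis (real N * t))))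
      has_integral 2 * pi * (\<Sum>n<N. (cmod (c n))\<^sup>2) + (cmod (c N))\<^sup>2 * (2 * pi) + 2 * 0) {0..2 * pi}"
    using has_integral_const_real[of "(cmod (c N))\<^sup>2" 0 "2 * pi"] Suc
    by (intro has_integral_add has_integral_mult_right cross) (auto simp: S_def mult_ac)
  moreover have "(cmod (S t + w))\<^sup>2 = (cmod (S t))\<^sup>2 + (cmod w)\<^sup>2 + 2 * Re (S t * cnj w)" for t w
    unfolding cmod_power2 by (simp add: power2_eq_square algebra_simps)
  from this[of _ "c N * cis (real N * _)"]
  have "(cmod (S t))\<^sup>2 + (cmod (c N))\<^sup>2 + 2 * Re (S t * cnj (c N * cis (real N * t)))
      = (cmod (\<Sum>n<Suc N. c n * cis (real n * t)))\<^sup>2" for t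
    by (simp add: S_def norm_mult)
  ultimately show ?case by (simp add: algebra_simps)
qed simp

text \<open>The shift \<open>u\<close> makes it visible that the mean square over a circle does not depend on the point where
  the circle is started.\<close>
lemma power_series_parseval:
  fixes c :: "nat \<Rightarrow> complex"
  assumes P: "\<And>z. cmod z < 1 \<Longrightarrow> (\<lambda>n. c n * z ^ n) sums P z" and r: "0 \<le> r" "r < 1"
  shows "(\<lambda>n. 2 * pi * ((cmod (c n))\<^sup>2 * r ^ (2 * n))) sums integral {0..2 * pi} (\<lambda>t. (cmod (P (of_real r * cis (u + t))))\<^sup>2)"
proof -
  define d where "d = (\<lambda>n. c n * of_real r ^ n * cis (real n * u))"
  define S where "S = (\<lambda>N t. \<Sum>n<N. d n * cis (real n * t))"
  define Q where "Q = (\<lambda>t. P (of_real r * cis (u + t)))"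
  have d: "d n * cis (real n * t) = c n * (of_real r * cis (u + t)) ^ n" for n t
    by (simp add: d_def power_mult_distrib Complex.DeMoivre cis_mult algebra_simps)
  have Q: "(\<lambda>n. d n * cis (real n * t)) sums Q t" for t
    unfolding d Q_def using r by (intro P) (simp add: norm_mult)
  have nd: "norm (d n) = norm (c n * of_real r ^ n)" for n by (simp add: d_def norm_mult)
  obtain R where R: "r < R" "R < 1" using r dense by blast
  have "summable (\<lambda>n. c n * of_real R ^ n)"
    using P[of "of_real R"] R r by (intro sums_summable) auto
  then have "summable (\<lambda>n. norm (c n * of_real r ^ n))"
    by (rule powser_insidea) (use R r in auto)
  then have "uniform_limit UNIV (\<lambda>N t. \<Sum>n<N. d n * cis (real n * t)) (\<lambda>t. \<Sum>n. d n * cis (real n * t)) sequentially"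
    by (intro Weierstrass_m_test) (auto simp: norm_mult nd)
  moreover have "(\<Sum>n. d n * cis (real n * t)) = Q t" for t using sums_unique[OF Q] by simp
  ultimately have "uniform_limit UNIV S Q sequentially" by (simp add: S_def)
  then have uS: "uniform_limit {0..2 * pi} S Q sequentially" by (rule uniform_limit_on_subset) simp
  have contS: "continuous_on {0..2 * pi} (S N)" for N
    unfolding S_def cis_conv_exp by (intro continuous_intros)
  have contQ: "continuous_on {0..2 * pi} Q"
    by (rule uniform_limit_theorem[OF _ uS]) (use contS in auto)
  have bQ: "bounded (Q ` {0..2 * pi})"
    by (intro compact_imp_bounded compact_continuous_image contQ) auto
  have bcQ: "bounded ((\<lambda>t. cnj (Q t)) ` {0..2 * pi})"
    by (intro compact_imp_bounded compact_continuous_image continuous_intros contQ) auto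
  have "uniform_limit {0..2 * pi} (\<lambda>N t. cnj (S N t)) (\<lambda>t. cnj (Q t)) sequentially"
    by (rule bounded_linear.uniform_limit[OF bounded_linear_cnj uS])
  from uniform_lim_mult[OF uS this bQ bcQ]
  have "uniform_limit {0..2 * pi} (\<lambda>N t. Re (S N t * cnj (S N t))) (\<lambda>t. Re (Q t * cnj (Q t))) sequentially"
    by (rule bounded_linear.uniform_limit[OF bounded_linear_Re])
  moreover have sq: "Re (w * cnj w) = (cmod w)\<^sup>2" for w
    by (metis Re_complex_of_real complex_norm_square)
  ultimately have lim2: "uniform_limit {0..2 * pi} (\<lambda>N t. (cmod (S N t))\<^sup>2) (\<lambda>t. (cmod (Q t))\<^sup>2) sequentially"
    by (simp only: sq)
  have cont2: "continuous_on {0..2 * pi} (\<lambda>t. (cmod (S N t))\<^sup>2)" for N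
    by (intro continuous_intros contS)
  obtain I J where I: "\<And>N. ((\<lambda>t. (cmod (S N t))\<^sup>2) has_integral I N) {0..2 * pi}"
    and J: "((\<lambda>t. (cmod (Q t))\<^sup>2) has_integral J) {0..2 * pi}" and "I \<longlonglongrightarrow> J"
    by (rule uniform_limit_integral[OF lim2 cont2 sequentially_bot]) (rule that)
  have "I N = (\<Sum>n<N. 2 * pi * ((cmod (c n))\<^sup>2 * r ^ (2 * n)))" for N
  proof -
    have "I N = 2 * pi * (\<Sum>n<N. (cmod (d n))\<^sup>2)"
      using has_integral_unique[OF I[of N, unfolded S_def] trig_polynomial_parseval] .
    moreover have "(cmod (d n))\<^sup>2 = (cmod (c n))\<^sup>2 * r ^ (2 * n)" for n
      using r by (simp add: nd norm_mult norm_power power_mult_distrib power_even_eq)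
    ultimately show ?thesis by (simp add: sum_distrib_left)
  qed
  then have "(\<lambda>n. 2 * pi * ((cmod (c n))\<^sup>2 * r ^ (2 * n))) sums J"
    using \<open>I \<longlonglongrightarrow> J\<close> unfolding sums_def by presburger
  then show ?thesis using integral_unique[OF J] unfolding Q_def by simp
qed

section \<open>From a differential inequality to weighted summability\<close>

text \<open>Gronwall's argument. The tail \<open>E x\<close>, the integral of \<open>r * A r\<close> from \<open>x\<close> to \<open>R\<close>, has derivative
  \<open>- x * A x\<close>, so the hypothesis reads \<open>E \<le> - C * (1 - x) / x * E'\<close>. Hence \<open>E x * (1 - x) powr (- \<beta>)\<close>
  does not increase if \<open>\<beta> * C \<le> 1/2 \<le> x\<close>. All constants are independent of \<open>R\<close>.\<close>
lemma tail_integral_decay: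
  fixes A :: "real \<Rightarrow> real"
  assumes cont: "continuous_on {0..<1} A" and nonneg: "\<And>r. 0 \<le> r \<Longrightarrow> r < 1 \<Longrightarrow> A r \<ge> 0" and C: "C \<ge> 0"
    and ineq: "\<And>\<rho> R. 1/2 \<le> \<rho> \<Longrightarrow> \<rho> < R \<Longrightarrow> R < 1 \<Longrightarrow> integral {\<rho>..R} (\<lambda>r. r * A r) \<le> C * (1 - \<rho>) * A \<rho>"
  obtains \<beta> C' where "\<beta> > 0" "C' \<ge> 0"
    "\<And>\<rho> R. 1/2 \<le> \<rho> \<Longrightarrow> \<rho> < R \<Longrightarrow> R < 1 \<Longrightarrow> integral {\<rho>..R} (\<lambda>r. r * A r) \<le> C' * (1 - \<rho>) powr \<beta>"
proof -
  define \<beta> where "\<beta> = 1 / (2 * C + 2)"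
  have \<beta>: "\<beta> > 0" "\<beta> * C \<le> 1/2" using C by (auto simp: \<beta>_def field_simps)
  define C' where "C' = C * (1 - 1/2) * A (1/2) * 2 powr \<beta>"
  have "C' \<ge> 0" using C nonneg[of "1/2"] by (simp add: C'_def)
  moreover have "integral {\<rho>..R} (\<lambda>r. r * A r) \<le> C' * (1 - \<rho>) powr \<beta>"
    if \<rho>: "1/2 \<le> \<rho>" and R: "\<rho> < R" "R < 1" for \<rho> R
  proof -
    define B where "B = (\<lambda>r. r * A r)"
    have contB: "continuous_on {0..R} B"
      unfolding B_def using R by (intro continuous_intros continuous_on_subset[OF cont]) auto
    have intB: "B integrable_on {x..y}" if "0 \<le> x" "y \<le> R" for x y
      using that by (intro integrable_continuous_interval continuous_on_subset[OF contB]) auto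
    define E where "E = (\<lambda>x. integral {0..R} B - integral {0..x} B)"
    have E: "E x = integral {x..R} B" if "0 \<le> x" "x \<le> R" for x
      using Henstock_Kurzweil_Integration.integral_combine[OF that intB] by (simp add: E_def)
    have dE: "(E has_real_derivative - B x) (at x)" if "0 < x" "x < R" for x
    proof -
      have "((\<lambda>x. integral {0..x} B) has_real_derivative B x) (at x within {0..R})"
        using that by (intro integral_has_real_derivative contB) auto
      then have "((\<lambda>x. integral {0..x} B) has_real_derivative B x) (at x)"
        using that by (simp add: at_within_Icc_at)
      then show ?thesis unfolding E_def by (auto intro!: derivative_eq_intros)
    qed
    define W where "W = (\<lambda>x. E x * (1 - x) powr (- \<beta>))"
    have "W \<rho> \<le> W (1/2)"
    proof (rule DERIV_nonpos_imp_nonincreasing[OF \<rho>])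
      fix x assume x: "1/2 \<le> x" "x \<le> \<rho>"
      have "(W has_real_derivative - B x * (1 - x) powr (- \<beta>) + E x * (\<beta> * (1 - x) powr (- \<beta> - 1))) (at x)"
        unfolding W_def using x R \<rho> dE[of x] by (auto intro!: derivative_eq_intros)
      moreover have "- B x * (1 - x) powr (- \<beta>) + E x * (\<beta> * (1 - x) powr (- \<beta> - 1)) \<le> 0"
      proof -
        have "E x \<le> C * (1 - x) * A x" using ineq[of x R] x R E[of x] by (simp add: B_def)
        then have "E x * \<beta> \<le> C * (1 - x) * A x * \<beta>" using \<beta> by (intro mult_right_mono) auto
        also have "\<dots> = (\<beta> * C) * ((1 - x) * A x)" by (simp add: mult_ac)
        also have "\<dots> \<le> x * ((1 - x) * A x)"
          using x \<beta> R nonneg[of x] by (intro mult_right_mono) auto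
        finally have "E x * \<beta> \<le> B x * (1 - x)" by (simp add: B_def mult_ac)
        then have "E x * \<beta> * (1 - x) powr (- \<beta> - 1) \<le> B x * (1 - x) * (1 - x) powr (- \<beta> - 1)"
          by (intro mult_right_mono) auto
        moreover have "(1 - x) * (1 - x) powr (- \<beta> - 1) = (1 - x) powr (- \<beta>)"
          using x R by (simp add: powr_mult_base)
        ultimately show ?thesis by (simp add: mult.assoc)
      qed
      ultimately show "\<exists>y. (W has_real_derivative y) (at x) \<and> y \<le> 0" by blast
    qed
    also have "W (1/2) = E (1/2) * 2 powr \<beta>"
      by (simp add: W_def powr_minus_divide powr_divide)
    also have "\<dots> \<le> C'"
      unfolding C'_def using ineq[of "1/2" R] E[of "1/2"] R \<rho> by (intro mult_right_mono) (auto simp: B_def)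
    finally have "E \<rho> * (1 - \<rho>) powr (- \<beta>) * (1 - \<rho>) powr \<beta> \<le> C' * (1 - \<rho>) powr \<beta>"
      unfolding W_def by (intro mult_right_mono) auto
    moreover have "(1 - \<rho>) powr (- \<beta>) * (1 - \<rho>) powr \<beta> = 1"
      using R by (simp flip: powr_add)
    ultimately have "E \<rho> \<le> C' * (1 - \<rho>) powr \<beta>" by (simp add: mult.assoc)
    then show ?thesis using E[of \<rho>] \<rho> R by (simp add: B_def)
  qed
  ultimately show thesis using that \<beta> by blast
qed

text \<open>On a dyadic block the weight costs \<open>2 powr (j * \<beta> / 2)\<close> while the tail gains \<open>2 powr (- j * \<beta>)\<close>, which
  leaves a geometric series.\<close>
lemma summable_powr_of_tail_decay:
  fixes e :: "nat \<Rightarrow> real"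
  assumes nonneg: "\<And>n. e n \<ge> 0" and \<beta>: "\<beta> > 0"
    and tail: "\<And>m N. m \<ge> 1 \<Longrightarrow> (\<Sum>n\<in>{m..<N}. e n) \<le> C * real m powr (-\<beta>)"
  shows "summable (\<lambda>n. real n powr (\<beta> / 2) * e n)"
proof -
  define \<gamma> where "\<gamma> = \<beta> / 2"
  have \<gamma>: "\<gamma> > 0" using \<beta> by (simp add: \<gamma>_def)
  define q where "q = 2 powr (-\<gamma>)"
  have q: "0 < q" "q < 1" using \<gamma> by (auto simp: q_def powr_less_one)
  have "C \<ge> 0" using tail[of 1 1] by simp
  define L where "L = C * 2 powr \<gamma>"
  have L: "L \<ge> 0" using \<open>C \<ge> 0\<close> by (simp add: L_def)
  have block: "(\<Sum>n\<in>{2^j..<2^Suc j}. real n powr \<gamma> * e n) \<le> L * q ^ j" for j :: nat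
  proof -
    have "(\<Sum>n\<in>{2^j..<2^Suc j}. real n powr \<gamma> * e n) \<le> (\<Sum>n\<in>{2^j..<2^Suc j}. (2^Suc j) powr \<gamma> * e n)"
    proof (intro sum_mono mult_right_mono powr_mono2)
      fix n :: nat assume "n \<in> {2^j..<2^Suc j}"
      then have "n \<le> 2 ^ Suc j" by simp
      then show "real n \<le> 2 ^ Suc j" by (metis of_nat_le_iff of_nat_numeral of_nat_power)
    qed (use \<gamma> nonneg in auto)
    also have "\<dots> = (2^Suc j) powr \<gamma> * (\<Sum>n\<in>{2^j..<2^Suc j}. e n)" by (simp add: sum_distrib_left)
    also have "\<dots> \<le> (2^Suc j) powr \<gamma> * (C * real (2^j) powr (-\<beta>))"
      by (intro mult_left_mono tail) auto
    also have "(2^Suc j::real) powr \<gamma> = 2 powr \<gamma> * (2 powr \<gamma>) ^ j"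
      by (simp add: powr_mult powr_power powr_powr mult.commute flip: powr_realpow)
    also have "real (2^j) powr (-\<beta>) = (2 powr (-\<beta>)) ^ j"
      by (simp add: powr_power powr_powr mult.commute flip: powr_realpow)
    also have "2 powr \<gamma> * (2 powr \<gamma>) ^ j * (C * (2 powr (-\<beta>)) ^ j) = L * (2 powr \<gamma> * 2 powr (-\<beta>)) ^ j"
      by (simp add: L_def power_mult_distrib mult_ac)
    also have "2 powr \<gamma> * 2 powr (-\<beta>) = q" by (simp add: q_def \<gamma>_def flip: powr_add)
    finally show ?thesis .
  qed
  have dyadic: "(\<Sum>n\<in>{1..<2^J}. real n powr \<gamma> * e n) \<le> L * (\<Sum>j<J. q ^ j)" for J :: nat
  proof (induction J)
    case (Suc J)
    have "{1..<2^Suc J} = {1..<2^J} \<union> {2^J..<2^Suc J::nat}" by (simp add: ivl_disj_un_two)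
    then have "(\<Sum>n\<in>{1..<2^Suc J}. real n powr \<gamma> * e n)
        = (\<Sum>n\<in>{1..<2^J}. real n powr \<gamma> * e n) + (\<Sum>n\<in>{2^J..<2^Suc J}. real n powr \<gamma> * e n)"
      by (metis (no_types, lifting) finite_atLeastLessThan ivl_disj_int_two(3) sum.union_disjoint)
    also have "\<dots> \<le> L * (\<Sum>j<J. q ^ j) + L * q ^ J" using Suc block by (intro add_mono)
    finally show ?case by (simp add: distrib_left)
  qed simp
  show ?thesis
  proof (rule summableI_nonneg_bounded)
    fix N :: nat
    have "(\<Sum>n<N. real n powr \<gamma> * e n) = (\<Sum>n\<in>{1..<N}. real n powr \<gamma> * e n)"
      using \<gamma> by (intro sum.mono_neutral_right) (auto simp: not_le)
    also have "\<dots> \<le> (\<Sum>n\<in>{1..<2^N}. real n powr \<gamma> * e n)"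
      using nonneg less_exp[of N] by (intro sum_mono2) (auto intro: less_trans)
    also have "\<dots> \<le> L * (\<Sum>j<N. q ^ j)" by (rule dyadic)
    also have "\<dots> \<le> L * (1 / (1 - q))"
    proof (intro mult_left_mono L)
      have "(\<Sum>j<N. q ^ j) \<le> (\<Sum>j. q ^ j)" using q by (intro sum_le_suminf) auto
      then show "(\<Sum>j<N. q ^ j) \<le> 1 / (1 - q)" using q by (simp add: suminf_geometric)
    qed
    finally show "(\<Sum>n<N. real n powr (\<beta> / 2) * e n) \<le> L * (1 / (1 - q))" by (simp add: \<gamma>_def)
  qed (use nonneg in auto)
qed

section \<open>Energy near the boundary and the coefficients\<close>

lemma cis_eqD:
  assumes "cis x = cis y" "\<bar>x - y\<bar> < 2 * pi"
  shows "x = y"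
proof -
  have "cos (x - y) = 1"
    using assms(1) sin_cos_squared_add[of y] by (simp add: complex_eq_iff cos_diff power2_eq_square)
  then obtain n :: int where n: "x - y = of_int n * 2 * pi"
    using cos_one_2pi_int by blast
  then have "real_of_int \<bar>n\<bar> * (2 * pi) < 1 * (2 * pi)"
    using assms(2) by (simp add: abs_mult mult_ac)
  then have "real_of_int \<bar>n\<bar> < 1" by (simp only: mult_less_cancel_right_pos pi_gt_zero mult_pos_pos zero_less_numeral)
  then have "n = 0" by linarith
  then show ?thesis using n by simp
qed

lemma continuous_on_circle_integral:
  assumes "p holomorphic_on ball 0 1"
  shows "continuous_on {0..<1} (\<lambda>r. integral {0..2 * pi} (\<lambda>t. (cmod (p (of_real r * cis t)))\<^sup>2))"
proof -
  have "continuous_on ({0..<1} \<times> cbox 0 (2 * pi)) (\<lambda>(r, t). (cmod (p (of_real r * cis t)))\<^sup>2)"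
    unfolding case_prod_beta cis_conv_exp
    by (intro continuous_intros continuous_on_compose2[OF holomorphic_on_imp_continuous_on[OF assms]])
      (auto simp: norm_mult)
  from integral_continuous_on_param[OF this] show ?thesis by simp
qed

text \<open>Let \<open>s = 1 - \<rho>\<close>. For each direction \<open>\<theta>\<close> the part of the Carleson box of \<open>\<rho> * cis \<theta>\<close> in \<open>\<bar>\<zeta>\<bar> \<le> R\<close>
  is mapped into a disc of radius \<open>M * s * \<bar>h' (\<rho> * cis \<theta>)\<bar>\<close>, so its energy is at most a constant times
  \<open>s\<^sup>2 * \<bar>h' (\<rho> * cis \<theta>)\<bar>\<^sup>2\<close>. Now integrate over \<open>\<theta>\<close>: each point of the annulus lies in the boxes of a set of
  directions of length \<open>2 * \<pi> * s\<close>, so the left side becomes \<open>2 * \<pi> * s\<close> times the energy of the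
  annulus, and one factor \<open>s\<close> remains on the right. Averaging over all directions avoids any
  covering by finitely many boxes.\<close>
lemma annulus_energy_le:
  fixes h g F :: "complex \<Rightarrow> complex"
  assumes hol: "h holomorphic_on ball 0 1" "g holomorphic_on ball 0 1"
    and le: "\<And>w. w \<in> ball 0 1 \<Longrightarrow> cmod (deriv g w) \<le> cmod (deriv h w)"
    and K: "K \<ge> 0" "\<And>w. w \<in> ball 0 1 \<Longrightarrow> (cmod (deriv h w))\<^sup>2 \<le> K * ((cmod (deriv h w))\<^sup>2 - (cmod (deriv g w))\<^sup>2)"
    and F: "\<And>w. F w = h w + cnj (g w)" and inj: "inj_on F (ball 0 1)"
    and M: "M \<ge> 0"
    and disp: "\<And>\<rho> r \<theta> u. 0 < \<rho> \<Longrightarrow> \<rho> \<le> r \<Longrightarrow> r < 1 \<Longrightarrow> \<bar>u\<bar> \<le> pi * (1 - \<rho>) \<Longrightarrow>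
      cmod (F (of_real r * cis (\<theta> + u)) - F (of_real \<rho> * cis \<theta>)) \<le> M * (1 - \<rho>) * cmod (deriv h (of_real \<rho> * cis \<theta>))"
    and A: "\<And>r u. 0 \<le> r \<Longrightarrow> r < 1 \<Longrightarrow> integral {0..2 * pi} (\<lambda>t. (cmod (deriv h (of_real r * cis (u + t))))\<^sup>2) = A r"
    and \<rho>: "1/2 \<le> \<rho>" "\<rho> < R" "R < 1"
  shows "integral {\<rho>..R} (\<lambda>r. r * A r) \<le> K * M\<^sup>2 / 2 * (1 - \<rho>) * A \<rho>"
proof -
  define \<alpha> where "\<alpha> = pi * (1 - \<rho>)"
  have \<alpha>: "0 < \<alpha>" "2 * \<alpha> < 2 * pi" using \<rho> by (auto simp: \<alpha>_def)
  define Q where "Q = cbox (\<rho>, -\<alpha>) (R, \<alpha>)"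
  define P where "P = (\<lambda>\<theta> p. of_real (fst p) * cis (\<theta> + snd p))"
  have Q: "\<rho> \<le> fst p" "fst p \<le> R" "\<bar>snd p\<bar> \<le> \<alpha>" if "p \<in> Q" for p
    using that by (auto simp: Q_def cbox_Pair_eq)
  have PD: "P \<theta> p \<in> ball 0 1" if "p \<in> Q" for \<theta> p
    using Q[OF that] \<rho> by (simp add: P_def norm_mult)
  have contdh: "continuous_on (ball 0 1) (deriv h)" and contdg: "continuous_on (ball 0 1) (deriv g)"
    using hol by (auto intro!: holomorphic_on_imp_continuous_on holomorphic_deriv)
  have contP: "continuous_on Q (P \<theta>)" for \<theta>
    unfolding P_def cis_conv_exp by (intro continuous_intros)
  define H where "H = (\<lambda>\<theta> p. fst p * (cmod (deriv h (P \<theta> p)))\<^sup>2)"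
  have contH: "continuous_on Q (H \<theta>)" for \<theta>
    unfolding H_def by (intro continuous_intros continuous_on_compose2[OF contdh contP]) (use PD in auto)
  have cont2: "continuous_on (S \<times> Q) (\<lambda>(\<theta>, p). H \<theta> p)" for S
    unfolding H_def case_prod_beta P_def cis_conv_exp
    by (intro continuous_intros continuous_on_compose2[OF contdh])
      (use PD in \<open>auto simp: P_def cis_conv_exp\<close>)
  have slice: "integral Q (H \<theta>) \<le> K * pi * M\<^sup>2 * (1 - \<rho>)\<^sup>2 * (cmod (deriv h (of_real \<rho> * cis \<theta>)))\<^sup>2" for \<theta>
  proof -
    define J where "J = (\<lambda>p. fst p * ((cmod (deriv h (P \<theta> p)))\<^sup>2 - (cmod (deriv g (P \<theta> p)))\<^sup>2))"
    have contJ: "continuous_on Q J"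
      unfolding J_def
      by (intro continuous_intros continuous_on_compose2[OF contdh contP] continuous_on_compose2[OF contdg contP])
        (use PD in auto)
    have injP: "inj_on (P \<theta>) Q"
    proof (rule inj_onI)
      fix p q assume *: "p \<in> Q" "q \<in> Q" "P \<theta> p = P \<theta> q"
      have pos: "fst p > 0" "fst q > 0" using Q[OF *(1)] Q[OF *(2)] \<rho> by linarith+
      have "cmod (P \<theta> p) = cmod (P \<theta> q)" using * by simp
      then have eq: "fst p = fst q" using pos by (simp add: P_def norm_mult)
      then have "cis (\<theta> + snd p) = cis (\<theta> + snd q)" using * pos by (simp add: P_def)
      then have "\<theta> + snd p = \<theta> + snd q"
        by (rule cis_eqD) (use Q(3)[OF *(1)] Q(3)[OF *(2)] \<alpha> in linarith)
      with eq show "p = q" by (simp add: prod_eq_iff)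
    qed
    have "integral Q (H \<theta>) \<le> integral Q (\<lambda>p. K * J p)"
    proof (rule integral_le)
      fix p assume p: "p \<in> Q"
      then have "fst p * (cmod (deriv h (P \<theta> p)))\<^sup>2
          \<le> fst p * (K * ((cmod (deriv h (P \<theta> p)))\<^sup>2 - (cmod (deriv g (P \<theta> p)))\<^sup>2))"
        using K(2)[OF PD[OF p]] Q[OF p] \<rho> by (intro mult_left_mono) auto
      then show "H \<theta> p \<le> K * J p" by (simp add: H_def J_def mult_ac)
    qed (use contH contJ in \<open>auto simp: Q_def intro!: integrable_continuous continuous_intros\<close>)
    also have "\<dots> = K * integral Q J" by simp
    also have "\<dots> \<le> K * (pi * (M * (1 - \<rho>) * cmod (deriv h (of_real \<rho> * cis \<theta>)))\<^sup>2)"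
      unfolding J_def P_def Q_def
    proof (rule mult_left_mono[OF polar_area_le[OF hol le F] K(1)])
      show "inj_on (F \<circ> (\<lambda>p. of_real (fst p) * cis (\<theta> + snd p))) (cbox (\<rho>, -\<alpha>) (R, \<alpha>))"
        using comp_inj_on[OF injP inj_on_subset[OF inj]] PD unfolding P_def Q_def by blast
      show "cmod (F (of_real (fst p) * cis (\<theta> + snd p)) - F (of_real \<rho> * cis \<theta>))
          \<le> M * (1 - \<rho>) * cmod (deriv h (of_real \<rho> * cis \<theta>))" if "p \<in> cbox (\<rho>, -\<alpha>) (R, \<alpha>)" for p
        using Q[of p] that \<rho> by (intro disp) (auto simp: Q_def \<alpha>_def)
    qed (use \<rho> M in auto)
    finally show ?thesis by (simp add: power_mult_distrib mult_ac)
  qed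
  have "2 * \<alpha> * integral {\<rho>..R} (\<lambda>r. r * A r) = integral {0..2 * pi} (\<lambda>\<theta>. integral Q (H \<theta>))"
  proof -
    have "integral (cbox 0 (2 * pi)) (\<lambda>\<theta>. integral Q (H \<theta>)) = integral Q (\<lambda>p. integral (cbox 0 (2 * pi)) (\<lambda>\<theta>. H \<theta> p))"
      unfolding Q_def
      by (rule integral_swap_continuous) (use cont2[of "cbox 0 (2 * pi)"] in \<open>simp add: Q_def cbox_Pair_eq\<close>)
    also have "\<dots> = integral Q (\<lambda>p. fst p * A (fst p))"
    proof (rule integral_cong)
      fix p assume "p \<in> Q"
      then have "0 \<le> fst p" "fst p < 1" using Q[of p] \<rho> by auto
      from A[OF this, of "snd p"] show "integral (cbox 0 (2 * pi)) (\<lambda>\<theta>. H \<theta> p) = fst p * A (fst p)"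
        by (simp add: H_def P_def add.commute)
    qed
    also have "\<dots> = integral (cbox \<rho> R) (\<lambda>r. integral (cbox (-\<alpha>) \<alpha>) (\<lambda>u. fst (r, u) * A (fst (r, u))))"
      unfolding Q_def
    proof (rule integral_prod_continuous)
      have "continuous_on {0..<1} A"
        using continuous_on_circle_integral[OF holomorphic_deriv[OF hol(1) open_ball]] A[where u = 0]
        by (simp cong: continuous_on_cong_simp)
      then have "continuous_on (cbox (\<rho>, -\<alpha>) (R, \<alpha>)) (\<lambda>p. A (fst p))"
        by (rule continuous_on_compose2) (use \<rho> in \<open>auto simp: cbox_Pair_eq intro!: continuous_intros\<close>)
      then show "continuous_on (cbox (\<rho>, -\<alpha>) (R, \<alpha>)) (\<lambda>p. fst p * A (fst p))"
        by (intro continuous_intros)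
    qed
    also have "\<dots> = integral {\<rho>..R} (\<lambda>r. 2 * \<alpha> * (r * A r))"
    proof -
      have "integral (cbox (-\<alpha>) \<alpha>) (\<lambda>u. r * A r) = 2 * \<alpha> * (r * A r)" for r
        using \<alpha> integral_const_real[of "r * A r" "-\<alpha>" \<alpha>] by (simp only: cbox_interval content_real_if) simp
      then show ?thesis by (simp only: fst_conv cbox_interval)
    qed
    also have "\<dots> = 2 * \<alpha> * integral {\<rho>..R} (\<lambda>r. r * A r)" by (rule integral_mult_right)
    finally show ?thesis by simp
  qed
  also have "\<dots> \<le> integral {0..2 * pi} (\<lambda>\<theta>. K * pi * M\<^sup>2 * (1 - \<rho>)\<^sup>2 * (cmod (deriv h (of_real \<rho> * cis \<theta>)))\<^sup>2)"
  proof (rule integral_le)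
    show "(\<lambda>\<theta>. integral Q (H \<theta>)) integrable_on {0..2 * pi}"
      using cont2[of "{0..2 * pi}"] unfolding Q_def
      by (intro integrable_continuous_interval integral_continuous_on_param)
    show "(\<lambda>\<theta>. K * pi * M\<^sup>2 * (1 - \<rho>)\<^sup>2 * (cmod (deriv h (of_real \<rho> * cis \<theta>)))\<^sup>2) integrable_on {0..2 * pi}"
      unfolding cis_conv_exp
      by (intro integrable_continuous_interval continuous_intros continuous_on_compose2[OF contdh])
        (use \<rho> in \<open>auto simp: norm_mult\<close>)
  qed (use slice in auto)
  also have "\<dots> = K * pi * M\<^sup>2 * (1 - \<rho>)\<^sup>2 * A \<rho>"
    using A[of \<rho> 0] \<rho> by simp
  also have "\<dots> = 2 * \<alpha> * (K * M\<^sup>2 / 2 * (1 - \<rho>) * A \<rho>)"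
    by (simp add: \<alpha>_def power2_eq_square)
  finally show ?thesis using \<alpha>(1) by simp
qed

lemma power_series_deriv_sums:
  fixes c :: "nat \<Rightarrow> complex"
  assumes "\<And>z. z \<in> ball 0 1 \<Longrightarrow> (\<lambda>n. c n * z ^ n) sums h z" and z: "cmod z < 1"
  shows "(\<lambda>n. diffs c n * z ^ n) sums deriv h z"
proof -
  have s: "summable (\<lambda>n. c n * z ^ n)" if "norm z < 1" for z
    using assms(1)[of z] that by (auto intro: sums_summable)
  have "((\<lambda>z. \<Sum>n. c n * z ^ n) has_field_derivative (\<Sum>n. diffs c n * z ^ n)) (at z)"
    by (rule termdiffs_strong'[OF s z])
  then have "(h has_field_derivative (\<Sum>n. diffs c n * z ^ n)) (at z)"
    by (rule has_field_derivative_transform_within_open[OF _ open_ball[of 0 1]])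
      (use z sums_unique[OF assms(1)] in auto)
  then have "deriv h z = (\<Sum>n. diffs c n * z ^ n)" by (rule DERIV_imp_deriv)
  moreover have "summable (\<lambda>n. diffs c n * z ^ n)" by (rule termdiff_converges[OF z s])
  ultimately show ?thesis by (simp add: summable_sums)
qed

text \<open>Integrating the mean squares over \<open>\<rho> \<le> r \<le> 1\<close> gives the terms \<open>\<pi> * n * \<bar>c n\<bar>\<^sup>2\<close> with the weights
  \<open>1 - \<rho> ^ (2 * n)\<close>. For \<open>\<rho> = 1 - 1 / (2 * m)\<close> these weights are at least \<open>1/2\<close> when \<open>n \<ge> m\<close>.\<close>
lemma coefficient_tail_of_energy_decay:
  fixes c :: "nat \<Rightarrow> complex"
  assumes \<beta>: "\<beta> > 0" and C: "C \<ge> 0"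
    and partial: "\<And>N r. 0 \<le> r \<Longrightarrow> r < 1 \<Longrightarrow> (\<Sum>n<N. 2 * pi * ((cmod (diffs c n))\<^sup>2 * r ^ (2 * n))) \<le> A r"
    and cont: "continuous_on {0..<1} A"
    and decay: "\<And>\<rho> R. 1/2 \<le> \<rho> \<Longrightarrow> \<rho> < R \<Longrightarrow> R < 1 \<Longrightarrow> integral {\<rho>..R} (\<lambda>r. r * A r) \<le> C * (1 - \<rho>) powr \<beta>"
    and m: "m \<ge> 1"
  shows "(\<Sum>n\<in>{m..<N}. real n * (cmod (c n))\<^sup>2) \<le> C * real m powr (-\<beta>)"
proof -
  define e where "e = (\<lambda>n. real n * (cmod (c n))\<^sup>2)"
  define \<rho> where "\<rho> = 1 - 1 / (2 * real m)"
  have \<rho>: "1/2 \<le> \<rho>" "\<rho> < 1" using m by (auto simp: \<rho>_def field_simps)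
  have R: "(\<Sum>n<N. pi * e (Suc n) * (R ^ (2 * Suc n) - \<rho> ^ (2 * Suc n))) \<le> C * (1 - \<rho>) powr \<beta>"
    if R: "\<rho> < R" "R < 1" for R
  proof -
    define p where "p = (\<lambda>r. \<Sum>n<N. pi * e (Suc n) * (2 * real (Suc n) * r ^ (2 * n + 1)))"
    have p: "p r = r * (\<Sum>n<N. 2 * pi * ((cmod (diffs c n))\<^sup>2 * r ^ (2 * n)))" for r
      by (simp add: p_def e_def diffs_def norm_mult power_mult_distrib sum_distrib_left power2_eq_square mult_ac
          del: of_nat_Suc)
    have "(p has_integral (\<Sum>n<N. pi * e (Suc n) * R ^ (2 * Suc n)) - (\<Sum>n<N. pi * e (Suc n) * \<rho> ^ (2 * Suc n))) {\<rho>..R}"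
    proof (rule fundamental_theorem_of_calculus)
      show "((\<lambda>r. \<Sum>n<N. pi * e (Suc n) * r ^ (2 * Suc n)) has_vector_derivative p r) (at r within {\<rho>..R})" for r
        unfolding p_def has_real_derivative_iff_has_vector_derivative[symmetric]
      proof (rule DERIV_subset[where s = UNIV])
        have "((\<lambda>r. r ^ (2 * Suc n)) has_real_derivative 2 * real (Suc n) * r ^ (2 * n + 1)) (at r)" for n
          by (rule DERIV_cong[OF DERIV_pow]) simp
        then show "((\<lambda>r. \<Sum>n<N. pi * e (Suc n) * r ^ (2 * Suc n)) has_real_derivative
            (\<Sum>n<N. pi * e (Suc n) * (2 * real (Suc n) * r ^ (2 * n + 1)))) (at r)"
          by (intro DERIV_sum DERIV_cmult)
      qed simp
    qed (use R in auto)
    then have int: "(p has_integral (\<Sum>n<N. pi * e (Suc n) * (R ^ (2 * Suc n) - \<rho> ^ (2 * Suc n)))) {\<rho>..R}"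
      by (simp add: sum_subtractf right_diff_distrib)
    have "(\<Sum>n<N. pi * e (Suc n) * (R ^ (2 * Suc n) - \<rho> ^ (2 * Suc n))) \<le> integral {\<rho>..R} (\<lambda>r. r * A r)"
    proof (rule has_integral_le[OF int])
      have "continuous_on {\<rho>..R} (\<lambda>r. r * A r)"
        using R \<rho> by (intro continuous_intros continuous_on_subset[OF cont]) auto
      then show "((\<lambda>r. r * A r) has_integral integral {\<rho>..R} (\<lambda>r. r * A r)) {\<rho>..R}"
        by (intro integrable_integral integrable_continuous_interval)
      show "p r \<le> r * A r" if "r \<in> {\<rho>..R}" for r
        unfolding p using partial[of r] R \<rho> that by (intro mult_left_mono) auto
    qed
    also have "\<dots> \<le> C * (1 - \<rho>) powr \<beta>" by (rule decay) (use \<rho> R in auto)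
    finally show ?thesis .
  qed
  have lim: "((\<lambda>R. \<Sum>n<N. pi * e (Suc n) * (R ^ (2 * Suc n) - \<rho> ^ (2 * Suc n)))
      \<longlongrightarrow> (\<Sum>n<N. pi * e (Suc n) * (1 ^ (2 * Suc n) - \<rho> ^ (2 * Suc n)))) (at_left 1)"
    by (intro tendsto_intros)
  have full: "(\<Sum>n<N. pi * e (Suc n) * (1 ^ (2 * Suc n) - \<rho> ^ (2 * Suc n))) \<le> C * (1 - \<rho>) powr \<beta>"
    by (rule tendsto_upperbound[OF lim])
      (use eventually_at_left_real[OF \<rho>(2)] R in \<open>auto elim!: eventually_mono\<close>)
  have half: "\<rho> ^ (2 * n) \<le> 1/2" if "m \<le> n" for n
  proof -
    have "\<rho> \<le> exp (- (1 / (2 * real m)))" using exp_ge_add_one_self[of "- (1 / (2 * real m))"] by (simp add: \<rho>_def)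
    then have "\<rho> ^ (2 * m) \<le> exp (- (1 / (2 * real m))) ^ (2 * m)" using \<rho> by (intro power_mono) auto
    also have "\<dots> = exp (-1)" using m by (simp add: exp_of_nat_mult[symmetric])
    also have "\<dots> \<le> 1/2" using exp_ge_add_one_self[of 1] by (simp add: exp_minus field_simps)
    finally have "\<rho> ^ (2 * m) \<le> 1/2" .
    moreover have "\<rho> ^ (2 * n) \<le> \<rho> ^ (2 * m)" using \<rho> that by (intro power_decreasing) auto
    ultimately show ?thesis by linarith
  qed
  have e0: "e n \<ge> 0" for n by (simp add: e_def)
  have "(\<Sum>n\<in>{m..<N}. e n) \<le> (\<Sum>n\<in>{m..<N}. pi * e n * (1 - \<rho> ^ (2 * n)))"
  proof (rule sum_mono)
    fix n assume "n \<in> {m..<N}"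
    then have "1 \<le> pi * (1 - \<rho> ^ (2 * n))"
      using half[of n] pi_gt3 mult_mono[of 2 pi "1/2" "1 - \<rho> ^ (2 * n)"] by auto
    then have "e n * 1 \<le> e n * (pi * (1 - \<rho> ^ (2 * n)))" by (intro mult_left_mono e0)
    then show "e n \<le> pi * e n * (1 - \<rho> ^ (2 * n))" by (simp add: mult_ac)
  qed
  also have "\<dots> \<le> (\<Sum>n\<in>{1..<Suc N}. pi * e n * (1 - \<rho> ^ (2 * n)))"
    using m \<rho> e0 by (intro sum_mono2) (auto intro!: mult_nonneg_nonneg power_le_one)
  also have "\<dots> = (\<Sum>n<N. pi * e (Suc n) * (1 ^ (2 * Suc n) - \<rho> ^ (2 * Suc n)))"
    unfolding One_nat_def sum.shift_bounds_Suc_ivl by (simp add: lessThan_atLeast0)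
  also have "\<dots> \<le> C * (1 - \<rho>) powr \<beta>" by (rule full)
  also have "\<dots> \<le> C * real m powr (-\<beta>)"
  proof (rule mult_left_mono[OF _ C])
    have "(1 - \<rho>) powr \<beta> \<le> (1 / real m) powr \<beta>"
      using m \<beta> by (intro powr_mono2) (auto simp: \<rho>_def field_simps)
    then show "(1 - \<rho>) powr \<beta> \<le> real m powr (-\<beta>)" using m by (simp add: powr_divide powr_minus_divide)
  qed
  finally show ?thesis by (simp add: e_def)
qed

section \<open>Summability of the coefficients\<close>

theorem theorem3:
  fixes K :: real and f h g :: "complex \<Rightarrow> complex" and a b :: "nat \<Rightarrow> complex"
  assumes "K \<ge> 1"
    and "f \<in> S_H0"
    and "canonical_decomposition f h g"
    and "quasiconformal K \<D> (f ` \<D>) f"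
    and "\<And>z. z \<in> \<D> \<Longrightarrow> (\<lambda>n. a (n + 2) * z ^ (n + 2)) sums (h z - z)"
    and "\<And>z. z \<in> \<D> \<Longrightarrow> (\<lambda>n. b (n + 2) * z ^ (n + 2)) sums g z"
    and "(\<exists>M1>0. \<forall>z\<in>\<D>.
            diam_le (f ` carleson_box z) (M1 * boundary_dist (f ` \<D>) (f z)))
       \<or> (\<exists>\<delta> M2. 0 < \<delta> \<and> \<delta> < 1 \<and> M2 > 0 \<and>
            (\<forall>z\<in>\<D>. \<forall>\<zeta>\<in>carleson_box z.
               norm_D f \<zeta> \<le> M2 * norm_D f z * ((1 - cmod \<zeta>) / (1 - cmod z)) powr (\<delta> - 1)))"
  shows "\<exists>\<beta>0>0. summable (\<lambda>n.
           real (n + 2) powr (1 + \<beta>0) * ((cmod (a (n + 2)))\<^sup>2 + (cmod (b (n + 2)))\<^sup>2))"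
proof -
  have hol: "h holomorphic_on \<D>" "g holomorphic_on \<D>"
    and f: "\<And>w. w \<in> \<D> \<Longrightarrow> f w = h w + cnj (g w)"
    using assms(3) by (auto simp: canonical_decomposition_def)
  have normD: "norm_D f w = cmod (deriv h w) + cmod (deriv g w)"
    and detD: "det_D f w = (cmod (deriv h w))\<^sup>2 - (cmod (deriv g w))\<^sup>2" if "w \<in> \<D>" for w
    using wirtinger_harmonic[OF assms(3) that] by (simp_all add: norm_D_def det_D_def)
  obtain k where homeo: "homeomorphism \<D> (f ` \<D>) f k"
    using assms(4) by (auto simp: quasiconformal_def)
  have sp: "sense_preserving_on \<D> f" using assms(4) by (simp add: quasiconformal_def)
  define \<kappa> where "\<kappa> = (K - 1) / (K + 1)"
  have \<kappa>: "0 \<le> \<kappa>" "\<kappa> < 1" using assms(1) by (auto simp: \<kappa>_def)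
  have dil: "(cmod (deriv h w) + cmod (deriv g w))\<^sup>2 \<le> K * ((cmod (deriv h w))\<^sup>2 - (cmod (deriv g w))\<^sup>2)"
    if "w \<in> \<D>" for w
    using assms(4) that by (simp add: quasiconformal_def normD detD)
  have le\<kappa>: "cmod (deriv g w) \<le> \<kappa> * cmod (deriv h w)"
    and hK: "(cmod (deriv h w))\<^sup>2 \<le> K * ((cmod (deriv h w))\<^sup>2 - (cmod (deriv g w))\<^sup>2)" if "w \<in> \<D>" for w
    using dilatation_bounds[OF norm_ge_zero norm_ge_zero dil[OF that] assms(1)] unfolding \<kappa>_def by auto
  have le: "cmod (deriv g w) \<le> cmod (deriv h w)" if "w \<in> \<D>" for w
    using le\<kappa>[OF that] \<kappa> mult_right_mono[of \<kappa> 1 "cmod (deriv h w)"] by simp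

  \<comment> \<open>The full coefficient sequences of h and g, starting at index 0.\<close>
  define c where "c = (\<lambda>n. if n = 0 then 0 else if n = 1 then 1 else a n)"
  define d where "d = (\<lambda>n. if n < 2 then 0 else b n)"
  have csums: "(\<lambda>n. c n * z ^ n) sums h z" if "z \<in> \<D>" for z
  proof -
    have "(\<lambda>n. c (n + 2) * z ^ (n + 2)) sums (h z - z)" using assms(5)[OF that] by (simp add: c_def)
    then have "(\<lambda>n. c n * z ^ n) sums (h z - z + (\<Sum>n<2. c n * z ^ n))"
      by (rule sums_iff_shift[of "\<lambda>n. c n * z ^ n" 2, THEN iffD1])
    then show ?thesis by (simp add: c_def numeral_2_eq_2)
  qed
  have dsums: "(\<lambda>n. d n * z ^ n) sums g z" if "z \<in> \<D>" for z
  proof -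
    have "(\<lambda>n. d (n + 2) * z ^ (n + 2)) sums g z" using assms(6)[OF that] by (simp add: d_def)
    then have "(\<lambda>n. d n * z ^ n) sums (g z + (\<Sum>n<2. d n * z ^ n))"
      by (rule sums_iff_shift[of "\<lambda>n. d n * z ^ n" 2, THEN iffD1])
    then show ?thesis by (simp add: d_def)
  qed
  have "(\<lambda>n. diffs c n * 0 ^ n) sums deriv h 0" by (rule power_series_deriv_sums[OF csums]) auto
  then have "deriv h 0 = 1" by (simp add: diffs_def c_def sums_unique2[OF _ powser_sums_zero])
  then have h0: "deriv h 0 \<noteq> 0" by simp
  have nz: "deriv h w \<noteq> 0" if "w \<in> \<D>" for w
    by (rule deriv_nonzero_of_sense_preserving[OF hol open_ball connected_ball f \<kappa> le\<kappa> sp _ h0 that]) simp_all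

  define F where "F = (\<lambda>w. h w + cnj (g w))"
  have fF: "f w = F w" if "w \<in> \<D>" for w using f[OF that] by (simp add: F_def)
  have injF: "inj_on F \<D>"
  proof (rule inj_onI)
    fix x y assume "x \<in> \<D>" "y \<in> \<D>" "F x = F y"
    then have "k (f x) = k (f y)" by (simp add: fF)
    then show "x = y"
      using homeomorphism_apply1[OF homeo \<open>x \<in> \<D>\<close>] homeomorphism_apply1[OF homeo \<open>y \<in> \<D>\<close>] by simp
  qed
  \<comment> \<open>Both alternatives say that f maps Carleson boxes to sets of conformally expected size.\<close>
  obtain M where M: "M \<ge> 0" and disp: "\<And>\<rho> r \<theta> u. 0 < \<rho> \<Longrightarrow> \<rho> \<le> r \<Longrightarrow> r < 1 \<Longrightarrow> \<bar>u\<bar> \<le> pi * (1 - \<rho>) \<Longrightarrow>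
      cmod (F (of_real r * cis (\<theta> + u)) - F (of_real \<rho> * cis \<theta>)) \<le> M * (1 - \<rho>) * cmod (deriv h (of_real \<rho> * cis \<theta>))"
    using assms(7)
  proof (elim disjE exE conjE)
    fix M1 :: real
    assume "M1 > 0" and b: "\<forall>z\<in>\<D>. diam_le (f ` carleson_box z) (M1 * boundary_dist (f ` \<D>) (f z))"
    show thesis
    proof (rule that[of "4 * M1"])
      fix \<rho> r \<theta> u :: real assume *: "0 < \<rho>" "\<rho> \<le> r" "r < 1" "\<bar>u\<bar> \<le> pi * (1 - \<rho>)"
      define z \<zeta> where "z = of_real \<rho> * cis \<theta>" and "\<zeta> = of_real r * cis (\<theta> + u)"
      have zD: "z \<in> \<D>" "\<zeta> \<in> \<D>" and zn: "cmod z = \<rho>" using * by (auto simp: z_def \<zeta>_def norm_mult)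
      have box: "\<zeta> \<in> carleson_box z" "z \<in> carleson_box z"
        using polar_mem_carleson_box[OF *] polar_mem_carleson_box[of \<rho> \<rho> 0 \<theta>] *
        by (auto simp: z_def \<zeta>_def)
      define D where "D = boundary_dist (f ` \<D>) (f z)"
      have "D \<le> 2 * (1 - (cmod z)\<^sup>2) * cmod (deriv h z)"
        unfolding D_def
        by (rule harmonic_koebe_upper[OF hol f nz le homeo zD(1) ball_boundary_dist_subset[OF imageI[OF zD(1)]]])
      also have "\<dots> \<le> 4 * (1 - \<rho>) * cmod (deriv h z)"
      proof (rule mult_right_mono)
        have "(1 - \<rho>) * (1 + \<rho>) \<le> (1 - \<rho>) * 2" using * by (intro mult_left_mono) auto
        then show "2 * (1 - (cmod z)\<^sup>2) \<le> 4 * (1 - \<rho>)" by (simp add: zn power2_eq_square algebra_simps)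
      qed simp
      finally have D: "D \<le> 4 * (1 - \<rho>) * cmod (deriv h z)" .
      have "dist (f \<zeta>) (f z) \<le> diameter (f ` carleson_box z)"
        using b zD(1) box by (intro diameter_bounded_bound) (auto simp: diam_le_def)
      also have "\<dots> \<le> M1 * D" using b zD(1) by (auto simp: diam_le_def D_def)
      also have "\<dots> \<le> M1 * (4 * (1 - \<rho>) * cmod (deriv h z))"
        using D \<open>M1 > 0\<close> by (intro mult_left_mono) auto
      finally have "cmod (F \<zeta> - F z) \<le> 4 * M1 * (1 - \<rho>) * cmod (deriv h z)"
        by (simp add: dist_norm fF[OF zD(1)] fF[OF zD(2)] mult_ac)
      then show "cmod (F (of_real r * cis (\<theta> + u)) - F (of_real \<rho> * cis \<theta>))
          \<le> 4 * M1 * (1 - \<rho>) * cmod (deriv h (of_real \<rho> * cis \<theta>))"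
        by (simp add: z_def \<zeta>_def)
    qed (use \<open>M1 > 0\<close> in auto)
  next
    fix \<delta> M2 :: real
    assume \<delta>: "0 < \<delta>" and "M2 > 0" and growth: "\<forall>z\<in>\<D>. \<forall>\<zeta>\<in>carleson_box z.
      norm_D f \<zeta> \<le> M2 * norm_D f z * ((1 - cmod \<zeta>) / (1 - cmod z)) powr (\<delta> - 1)"
    show thesis
    proof (rule that[of "2 * (M2 * (pi + 1 / \<delta>))"])
      fix \<rho> r \<theta> u :: real assume *: "0 < \<rho>" "\<rho> \<le> r" "r < 1" "\<bar>u\<bar> \<le> pi * (1 - \<rho>)"
      define z where "z = of_real \<rho> * cis \<theta>"
      have zD: "z \<in> \<D>" using * by (simp add: z_def norm_mult)
      have boxD: "carleson_box z \<subseteq> \<D>" by (auto simp: carleson_box_def)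
      define D where "D = (\<lambda>w. cmod (deriv h w) + cmod (deriv g w))"
      have "cmod (F (of_real r * cis (\<theta> + u)) - F z) \<le> M2 * (pi + 1 / \<delta>) * (1 - \<rho>) * D z"
      proof (rule displacement_of_derivative_growth[OF hol \<delta> _ _ z_def])
        show "D \<zeta> \<le> M2 * D z * ((1 - cmod \<zeta>) / (1 - cmod z)) powr (\<delta> - 1)" if "\<zeta> \<in> carleson_box z" for \<zeta>
          using growth[rule_format, OF zD that] normD[OF zD] normD[OF subsetD[OF boxD that]]
          unfolding D_def by simp
      qed (use * \<open>M2 > 0\<close> in \<open>auto simp: D_def F_def\<close>)
      also have "\<dots> \<le> M2 * (pi + 1 / \<delta>) * (1 - \<rho>) * (2 * cmod (deriv h z))"
        using le[OF zD] * \<open>M2 > 0\<close> \<delta> by (intro mult_left_mono) (auto simp: D_def)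
      finally show "cmod (F (of_real r * cis (\<theta> + u)) - F (of_real \<rho> * cis \<theta>))
          \<le> 2 * (M2 * (pi + 1 / \<delta>)) * (1 - \<rho>) * cmod (deriv h (of_real \<rho> * cis \<theta>))"
        by (simp add: z_def algebra_simps)
    qed (use \<open>M2 > 0\<close> \<delta> in auto)
  qed

  \<comment> \<open>The mean squares of h' and g' on circles; dominating B by A makes the decay for h
    serve for g as well.\<close>
  define A where "A = (\<lambda>r. integral {0..2 * pi} (\<lambda>t. (cmod (deriv h (of_real r * cis t)))\<^sup>2))"
  define B where "B = (\<lambda>r. integral {0..2 * pi} (\<lambda>t. (cmod (deriv g (of_real r * cis t)))\<^sup>2))"
  have hol': "deriv h holomorphic_on \<D>" "deriv g holomorphic_on \<D>" using hol by (auto intro: holomorphic_deriv)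
  have contA: "continuous_on {0..<1} A" and contB: "continuous_on {0..<1} B"
    unfolding A_def B_def using hol' by (auto intro: continuous_on_circle_integral)
  have Asums: "(\<lambda>n. 2 * pi * ((cmod (diffs c n))\<^sup>2 * r ^ (2 * n))) sums
      integral {0..2 * pi} (\<lambda>t. (cmod (deriv h (of_real r * cis (u + t))))\<^sup>2)" if "0 \<le> r" "r < 1" for r u
    by (rule power_series_parseval[OF power_series_deriv_sums[OF csums] that])
  have Bsums: "(\<lambda>n. 2 * pi * ((cmod (diffs d n))\<^sup>2 * r ^ (2 * n))) sums
      integral {0..2 * pi} (\<lambda>t. (cmod (deriv g (of_real r * cis (u + t))))\<^sup>2)" if "0 \<le> r" "r < 1" for r u
    by (rule power_series_parseval[OF power_series_deriv_sums[OF dsums] that])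
  have A: "integral {0..2 * pi} (\<lambda>t. (cmod (deriv h (of_real r * cis (u + t))))\<^sup>2) = A r"
    if "0 \<le> r" "r < 1" for r u
    using sums_unique2[OF Asums[OF that, of u] Asums[OF that, of 0]] by (simp add: A_def)
  have partialA: "(\<Sum>n<N. 2 * pi * ((cmod (diffs c n))\<^sup>2 * r ^ (2 * n))) \<le> A r" if "0 \<le> r" "r < 1" for N r
    using sum_le_suminf[OF sums_summable[OF Asums[OF that, of 0]], of "{..<N}"] sums_unique[OF Asums[OF that, of 0]] that
    by (simp add: A_def)
  have partialB: "(\<Sum>n<N. 2 * pi * ((cmod (diffs d n))\<^sup>2 * r ^ (2 * n))) \<le> B r" if "0 \<le> r" "r < 1" for N r
    using sum_le_suminf[OF sums_summable[OF Bsums[OF that, of 0]], of "{..<N}"] sums_unique[OF Bsums[OF that, of 0]] that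
    by (simp add: B_def)
  have BA: "B r \<le> A r" if "0 \<le> r" "r < 1" for r
    unfolding A_def B_def
  proof (rule integral_le)
    have m: "of_real r * cis t \<in> \<D>" for t using that by (simp add: norm_mult)
    show "(\<lambda>t. (cmod (deriv g (of_real r * cis t)))\<^sup>2) integrable_on {0..2 * pi}"
      "(\<lambda>t. (cmod (deriv h (of_real r * cis t)))\<^sup>2) integrable_on {0..2 * pi}"
      using m unfolding cis_conv_exp
      by (intro integrable_continuous_interval continuous_intros
            continuous_on_compose2[OF holomorphic_on_imp_continuous_on[OF hol'(1)]]
            continuous_on_compose2[OF holomorphic_on_imp_continuous_on[OF hol'(2)]]; auto)+
    show "(cmod (deriv g (of_real r * cis t)))\<^sup>2 \<le> (cmod (deriv h (of_real r * cis t)))\<^sup>2" for t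
      using le[OF m] by (intro power_mono) auto
  qed
  have A0: "A r \<ge> 0" if "0 \<le> r" "r < 1" for r using partialA[OF that, of 0] by simp
  obtain \<beta> C where \<beta>: "\<beta> > 0" and C: "C \<ge> 0" and decayA: "\<And>\<rho> R. 1/2 \<le> \<rho> \<Longrightarrow> \<rho> < R \<Longrightarrow> R < 1 \<Longrightarrow>
      integral {\<rho>..R} (\<lambda>r. r * A r) \<le> C * (1 - \<rho>) powr \<beta>"
  proof (rule tail_integral_decay[OF contA A0])
    show "0 \<le> K * M\<^sup>2 / 2" using assms(1) by simp
    show "integral {\<rho>..R} (\<lambda>r. r * A r) \<le> K * M\<^sup>2 / 2 * (1 - \<rho>) * A \<rho>" if "1/2 \<le> \<rho>" "\<rho> < R" "R < 1" for \<rho> R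
      by (rule annulus_energy_le[OF hol le _ hK _ injF M disp A that]) (use assms(1) in \<open>auto simp: F_def\<close>)
  qed (assumption+, rule that)
  have decayB: "integral {\<rho>..R} (\<lambda>r. r * B r) \<le> C * (1 - \<rho>) powr \<beta>" if "1/2 \<le> \<rho>" "\<rho> < R" "R < 1" for \<rho> R
  proof -
    have "integral {\<rho>..R} (\<lambda>r. r * B r) \<le> integral {\<rho>..R} (\<lambda>r. r * A r)"
      using that BA
      by (intro integral_le integrable_continuous_interval continuous_intros mult_left_mono
          continuous_on_subset[OF contA] continuous_on_subset[OF contB]) auto
    then show ?thesis using decayA[OF that] by simp
  qed
  have "summable (\<lambda>n. real n powr (\<beta> / 2) * (real n * (cmod (c n))\<^sup>2))"
    by (rule summable_powr_of_tail_decay[OF _ \<beta>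
          coefficient_tail_of_energy_decay[OF \<beta> C partialA contA decayA]]) auto
  moreover have "summable (\<lambda>n. real n powr (\<beta> / 2) * (real n * (cmod (d n))\<^sup>2))"
    by (rule summable_powr_of_tail_decay[OF _ \<beta>
          coefficient_tail_of_energy_decay[OF \<beta> C partialB contB decayB]]) auto
  ultimately have "summable (\<lambda>n. real n powr (\<beta> / 2) * (real n * (cmod (c n))\<^sup>2)
      + real n powr (\<beta> / 2) * (real n * (cmod (d n))\<^sup>2))"
    by (rule summable_add)
  then have "summable (\<lambda>n. real (n + 2) powr (\<beta> / 2) * (real (n + 2) * (cmod (c (n + 2)))\<^sup>2)
      + real (n + 2) powr (\<beta> / 2) * (real (n + 2) * (cmod (d (n + 2)))\<^sup>2))"
    by (rule summable_ignore_initial_segment)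
  moreover have "real (n + 2) powr (\<beta> / 2) * (real (n + 2) * (cmod (c (n + 2)))\<^sup>2)
      + real (n + 2) powr (\<beta> / 2) * (real (n + 2) * (cmod (d (n + 2)))\<^sup>2)
      = real (n + 2) powr (1 + \<beta> / 2) * ((cmod (a (n + 2)))\<^sup>2 + (cmod (b (n + 2)))\<^sup>2)" for n
  proof -
    have "real (n + 2) powr (1 + \<beta> / 2) = real (n + 2) * real (n + 2) powr (\<beta> / 2)"
      by (simp add: powr_mult_base)
    then show ?thesis by (simp add: c_def d_def algebra_simps)
  qed
  ultimately have "summable (\<lambda>n. real (n + 2) powr (1 + \<beta> / 2) * ((cmod (a (n + 2)))\<^sup>2 + (cmod (b (n + 2)))\<^sup>2))"
    by simp
  then show ?thesis using \<beta> by (intro exI[of _ "\<beta> / 2"]) auto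
qed

end
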